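(* For every $w\in S_n$, the map $\Phi$ (removing the pipes labeled by left-to-right maxima of $w^{-1}$ and marking each R-tile that arises from a cross tile) is a bijection from $\mathsf{PD}(w)$ to $\mathsf{MVPD}(w)$ that preserves $\mathsf{wty}(\cdot)$, i.e. $\mathsf{wty}(\Phi(P))=\mathsf{wty}(P)$ for all $P\in\mathsf{PD}(w)$.
   Context: Fix an integer $n\ge 1$. Cells $(i,j)$ of the $n\times n$ grid: row $i$ counted from the top, column $j$ counted from the left. Tiles. A cell is filled with one of: the blank tile; the H-tile (one strand joining the left and right edges); the J-tile (one strand joining the left and top edges); the R-tile (one strand joining the bottom and right edges, unmarked); the marked R-tile (an R-tile carrying a mark); the bump tile (two strands, one joining left and top, the other joining bottom and right); the cross tile (strands meeting all four edges). Neighbouring tiles must match along shared edges; pipes enter through the left boundary and exit through the top boundary (no strand meets the right or bottom boundary). Tracing pipes. The pipe entering from row $p$ is called pipe $p$. Pipes are traced from left to top, processing rows from bottom to top and cells in a row from left to right. At a cross tile where pipe $p$ enters from the left and pipe $q$ from the bottom: if $p$ and $q$ have not crossed before, they cross in this tile, $p$ exits right and $q$ exits top; otherwise they do not cross here, $p$ exits top and $q$ exits right. (Equivalently, pipe $\max(p,q)$ exits top.) Pipe dreams. A pipe dream (PD) is such a tiling of the $n\times n$ grid by cross, bump, J- and blank tiles with a pipe entering from every row and exiting from every column (so J-tiles are exactly at $i+j=n+1$, blanks at $i+j>n+1$, cross or bump tiles at $i+j\le n$). $\mathsf{PD}(w)$ is the set of PDs such that for each $c$ the pipe exiting at the top of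 column $c$ is pipe $w^{-1}(c)$. $\mathsf{wty}(P)$ is the set of cells of the PD $P$ that are cross tiles. MVPDs. A vertical-less pipe dream is such a tiling of the $n\times n$ grid by blank, H-, cross, J-, R- and bump tiles. A marked vertical-less pipe dream (MVPD) is a vertical-less pipe dream in which some R-tiles are marked, where the pipe in a marked tile is required to pass through an H-tile in a row strictly below the marked tile. Its column-to-row code is the length-$n$ sequence whose $c$-th entry is $r$ if pipe $r$ exits at the top of column $c$, and $0$ if no pipe exits there. $\mathsf{wty}(M)$ is the set of cells of the MVPD $M$ that are H-tiles, cross tiles or marked R-tiles. The left-to-right maxima of a permutation $u$ are the numbers $u(i)$ with $u(j)<u(i)$ for all $j<i$. $\alpha'(w)$ is obtained from $(w^{-1}(1),\dots,w^{-1}(n))$ by replacing each left-to-right maximum of $w^{-1}$ by $0$. $\mathsf{MVPD}(w)$ is the set of MVPDs with column-to-row code $\alpha'(w)$. The map $\Phi$. Given $P\in\mathsf{PD}(w)$, remove from $P$ all pipes labeled by left-to-right maxima of $w^{-1}$. If a cross tile of $P$ becomes an R-tile after the removal, mark it. $\Phi(P)$ is the resulting tiling. *)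

theory Defs
  imports "HOL-Combinatorics.Permutations"
begin

section \<open>Tilings\<close>

text \<open>
  \<open>VTile\<close> (one strand joining bottom and top) is not a tile of any pipe dream below.  It only
  makes the removal of pipes a total operation on tilings.
\<close>

datatype tile = Blank | HTile | JTile | RTile | MarkedR | Bump | Cross | VTile

definition meets_left :: "tile \<Rightarrow> bool" where
  "meets_left t \<longleftrightarrow> t \<in> {HTile, JTile, Bump, Cross}"

definition meets_right :: "tile \<Rightarrow> bool" where
  "meets_right t \<longleftrightarrow> t \<in> {HTile, RTile, MarkedR, Bump, Cross}"

definition meets_top :: "tile \<Rightarrow> bool" where
  "meets_top t \<longleftrightarrow> t \<in> {JTile, Bump, Cross, VTile}"

definition meets_bottom :: "tile \<Rightarrow> bool" where
  "meets_bottom t \<longleftrightarrow> t \<in> {RTile, MarkedR, Bump, Cross, VTile}"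

text \<open>
  The cell \<open>(i, j)\<close> lies in row \<open>i\<close> counted from the top and column \<open>j\<close> counted from the left,
  both starting at 1.
\<close>

type_synonym cell = "nat \<times> nat"
type_synonym tiling = "cell \<Rightarrow> tile"

definition grid :: "nat \<Rightarrow> cell set" where
  "grid n = {1..n} \<times> {1..n}"

text \<open>
  A tiling of the grid is represented by a function on all pairs; it is blank off the grid, so that
  equality of functions is equality of tilings.
\<close>

definition tiling_of_grid :: "nat \<Rightarrow> tiling \<Rightarrow> bool" where
  "tiling_of_grid n T \<longleftrightarrow>
     (\<forall>c. c \<notin> grid n \<longrightarrow> T c = Blank) \<and>
     (\<forall>i\<in>{1..n}. \<forall>j\<in>{1..<n}. meets_right (T (i, j)) \<longleftrightarrow> meets_left (T (i, j + 1))) \<and>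
     (\<forall>i\<in>{1..<n}. \<forall>j\<in>{1..n}. meets_bottom (T (i, j)) \<longleftrightarrow> meets_top (T (i + 1, j))) \<and>
     (\<forall>i\<in>{1..n}. \<not> meets_right (T (i, n))) \<and>
     (\<forall>j\<in>{1..n}. \<not> meets_bottom (T (n, j)))"


section \<open>Tracing pipes\<close>

text \<open>
  Pipes are named by the row in which they enter, and 0 means that there is no pipe.  The state of
  the tracing consists of the pipe leaving each processed cell through its right edge, the pipe
  leaving each processed cell through its top edge, and the set of unordered pairs of pipes that
  have crossed so far.
\<close>

type_synonym trace_state = "(cell \<Rightarrow> nat) \<times> (cell \<Rightarrow> nat) \<times> nat set set"

definition left_input :: "tiling \<Rightarrow> (cell \<Rightarrow> nat) \<Rightarrow> cell \<Rightarrow> nat" where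
  "left_input T rt = (\<lambda>(i, j).
     if j = 1 then (if meets_left (T (i, j)) then i else 0) else rt (i, j - 1))"

definition bottom_input :: "(cell \<Rightarrow> nat) \<Rightarrow> cell \<Rightarrow> nat" where
  "bottom_input tp = (\<lambda>(i, j). tp (i + 1, j))"

text \<open>
  The pipes leaving a tile through its right and its top edge, given the pipes \<open>p\<close> and \<open>q\<close> at its
  left and its bottom edge; \<open>x\<close> tells whether \<open>p\<close> and \<open>q\<close> have crossed before.
\<close>

fun outputs :: "tile \<Rightarrow> bool \<Rightarrow> nat \<Rightarrow> nat \<Rightarrow> nat \<times> nat" where
  "outputs Blank x p q = (0, 0)"
| "outputs HTile x p q = (p, 0)"
| "outputs JTile x p q = (0, p)"
| "outputs RTile x p q = (q, 0)"
| "outputs MarkedR x p q = (q, 0)"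
| "outputs VTile x p q = (0, q)"
| "outputs Bump x p q = (q, p)"
| "outputs Cross x p q = (if x then (q, p) else (p, q))"

definition trace_step :: "tiling \<Rightarrow> cell \<Rightarrow> trace_state \<Rightarrow> trace_state" where
  "trace_step T c = (\<lambda>(rt, tp, X).
     let p = left_input T rt c;
         q = bottom_input tp c;
         (r, t) = outputs (T c) ({p, q} \<in> X) p q
     in (rt(c := r), tp(c := t), if T c = Cross then insert {p, q} X else X))"

definition reading_order :: "nat \<Rightarrow> cell list" where
  "reading_order n = concat (map (\<lambda>i. map (\<lambda>j. (i, j)) [1..<Suc n]) (rev [1..<Suc n]))"

text \<open>The initial top label 0 off the grid says that no pipe enters through the bottom boundary.\<close>

definition trace :: "nat \<Rightarrow> tiling \<Rightarrow> trace_state" where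
  "trace n T = fold (trace_step T) (reading_order n) (\<lambda>_. 0, \<lambda>_. 0, {})"

definition right_pipe :: "nat \<Rightarrow> tiling \<Rightarrow> cell \<Rightarrow> nat" where
  "right_pipe n T = fst (trace n T)"

definition top_pipe :: "nat \<Rightarrow> tiling \<Rightarrow> cell \<Rightarrow> nat" where
  "top_pipe n T = fst (snd (trace n T))"

definition left_pipe :: "nat \<Rightarrow> tiling \<Rightarrow> cell \<Rightarrow> nat" where
  "left_pipe n T = left_input T (right_pipe n T)"

definition bottom_pipe :: "nat \<Rightarrow> tiling \<Rightarrow> cell \<Rightarrow> nat" where
  "bottom_pipe n T = bottom_input (top_pipe n T)"


section \<open>Pipe dreams\<close>

definition pipe_dream :: "nat \<Rightarrow> tiling \<Rightarrow> bool" where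
  "pipe_dream n P \<longleftrightarrow>
     tiling_of_grid n P \<and>
     (\<forall>c\<in>grid n. P c \<in> {Cross, Bump, JTile, Blank}) \<and>
     (\<forall>i\<in>{1..n}. meets_left (P (i, 1))) \<and>
     (\<forall>j\<in>{1..n}. meets_top (P (1, j)))"

definition PD :: "nat \<Rightarrow> (nat \<Rightarrow> nat) \<Rightarrow> tiling set" where
  "PD n w = {P. pipe_dream n P \<and> (\<forall>c\<in>{1..n}. top_pipe n P (1, c) = inv w c)}"

definition wty_PD :: "nat \<Rightarrow> tiling \<Rightarrow> cell set" where
  "wty_PD n P = {c \<in> grid n. P c = Cross}"


section \<open>Marked vertical-less pipe dreams\<close>

fun unmark :: "tile \<Rightarrow> tile" where
  "unmark MarkedR = RTile"
| "unmark t = t"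

definition vertical_less_pipe_dream :: "nat \<Rightarrow> tiling \<Rightarrow> bool" where
  "vertical_less_pipe_dream n T \<longleftrightarrow>
     tiling_of_grid n T \<and>
     (\<forall>c\<in>grid n. T c \<in> {Blank, HTile, Cross, JTile, RTile, Bump})"

text \<open>The pipe in an R-tile is the one at its bottom edge; the pipe in an H-tile is the one at its
  left edge.\<close>

definition marked_vertical_less_pipe_dream :: "nat \<Rightarrow> tiling \<Rightarrow> bool" where
  "marked_vertical_less_pipe_dream n M \<longleftrightarrow>
     vertical_less_pipe_dream n (unmark \<circ> M) \<and>
     (\<forall>(i, j)\<in>grid n. M (i, j) = MarkedR \<longrightarrow>
        (\<exists>(i', j')\<in>grid n. i < i' \<and> M (i', j') = HTile \<and>
           left_pipe n M (i', j') = bottom_pipe n M (i, j)))"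

definition column_to_row_code :: "nat \<Rightarrow> tiling \<Rightarrow> nat list" where
  "column_to_row_code n M = map (\<lambda>c. top_pipe n M (1, c)) [1..<Suc n]"

definition left_to_right_maxima :: "nat \<Rightarrow> (nat \<Rightarrow> nat) \<Rightarrow> nat set" where
  "left_to_right_maxima n u = {u i |i. i \<in> {1..n} \<and> (\<forall>j\<in>{1..<i}. u j < u i)}"

definition alpha' :: "nat \<Rightarrow> (nat \<Rightarrow> nat) \<Rightarrow> nat list" where
  "alpha' n w =
     map (\<lambda>c. if inv w c \<in> left_to_right_maxima n (inv w) then 0 else inv w c) [1..<Suc n]"

definition MVPD :: "nat \<Rightarrow> (nat \<Rightarrow> nat) \<Rightarrow> tiling set" where
  "MVPD n w = {M. marked_vertical_less_pipe_dream n M \<and> column_to_row_code n M = alpha' n w}"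

definition wty_MVPD :: "nat \<Rightarrow> tiling \<Rightarrow> cell set" where
  "wty_MVPD n M = {c \<in> grid n. M c \<in> {HTile, Cross, MarkedR}}"


section \<open>Removing pipes\<close>

text \<open>
  What is left of a tile: \<open>k\<close> tells whether the strand at the left edge is kept, \<open>m\<close> whether the
  strand at the bottom edge is kept, and \<open>x\<close> whether the two pipes of a cross tile really cross in
  it (left to right and bottom to top) or merely touch (left to top and bottom to right).
  In the last equation an R-tile arises from a cross tile, so it gets a mark.
\<close>

fun rest_of_tile :: "tile \<Rightarrow> bool \<Rightarrow> bool \<Rightarrow> bool \<Rightarrow> tile" where
  "rest_of_tile Blank x k m = Blank"
| "rest_of_tile HTile x k m = (if k then HTile else Blank)"
| "rest_of_tile JTile x k m = (if k then JTile else Blank)"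
| "rest_of_tile RTile x k m = (if m then RTile else Blank)"
| "rest_of_tile MarkedR x k m = (if m then MarkedR else Blank)"
| "rest_of_tile VTile x k m = (if m then VTile else Blank)"
| "rest_of_tile Bump x k m =
     (if k then (if m then Bump else JTile) else (if m then RTile else Blank))"
| "rest_of_tile Cross True k m =
     (if k then (if m then Cross else HTile) else (if m then VTile else Blank))"
| "rest_of_tile Cross False k m =
     (if k then (if m then Cross else JTile) else (if m then MarkedR else Blank))"

definition remove_pipes :: "nat \<Rightarrow> nat set \<Rightarrow> tiling \<Rightarrow> tiling" where
  "remove_pipes n S T = (\<lambda>c.
     rest_of_tile (T c) (right_pipe n T c = left_pipe n T c)
       (left_pipe n T c \<notin> S) (bottom_pipe n T c \<notin> S))"

definition Phi :: "nat \<Rightarrow> (nat \<Rightarrow> nat) \<Rightarrow> tiling \<Rightarrow> tiling" where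
  "Phi n w P = remove_pipes n (left_to_right_maxima n (inv w)) P"

end

theory Submission
  imports Defs
begin

text \<open>
  While a tiling is traced, the boundary between the processed and the unprocessed cells is a
  lattice path.  Reading the pipes that cross this path from the top left to the bottom right gives
  a frontier word, with 0 where there is no pipe.  A cell \<open>(i, j)\<close> acts only on the entries
  \<open>i + j - 1\<close> and \<open>i + j\<close> of the word, which are the labels at its left and at its bottom edge: it
  either swaps them or leaves them in place (\<open>word_step\<close>).  In a cross tile with entries \<open>p\<close> and \<open>q\<close>
  in this order, the two pipes have crossed before exactly if \<open>q < p\<close>, because the word is increasing
  at the start and records the crossed pairs as its inversions (\<open>records_inversions_word\<close>).  So the
  memory of the tracing is in the word itself, cross tiles swap exactly the ascents, and an
  inversion of a frontier word is never undone.

  Let \<open>S\<close> be the set of left-to-right maxima of \<open>inv w\<close>, and let \<open>P\<close> be a pipe dream for \<open>w\<close>.  As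
  inversions persist and the last frontier word of \<open>P\<close> is \<open>inv w\<close>, a pipe in \<open>S\<close> never is the smaller
  pipe of an inversion, and so in a cross tile it always leaves through the top as the larger of the
  two pipes.  Its removal therefore turns the cross tile into an H-tile if the pipes cross there, and
  into a marked R-tile if they only touch.  In the second case the two pipes have crossed further
  down, and that crossing has become the H-tile that the mark demands.  No other tile becomes an
  H-tile, a cross tile or a marked R-tile, so the weight is preserved.  The frontier words of
  \<open>\<Phi>(P)\<close> are those of \<open>P\<close> with the labels in \<open>S\<close> replaced by 0 (\<open>word_remove_pipes\<close>).

  All pipe dreams have the same staircase shape, hence \<open>P\<close> is determined by its set of cross tiles
  (\<open>pipe_dream_eq\<close>), which is the weight of \<open>\<Phi>(P)\<close>.  So \<open>\<Phi>\<close> is injective.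

  For surjectivity, take the pipe dream \<open>P\<close> whose cross tiles are at the weight of a given \<open>M\<close>.  The
  frontier words of \<open>M\<close> and \<open>P\<close> are traced in parallel.  In each word of \<open>P\<close> the entries in \<open>S\<close> are
  left-to-right maxima, since these entries only ever move to the left past entries outside \<open>S\<close>.
  This makes the pipes cross in every tile that is an H-tile of \<open>M\<close>.  If \<open>q\<close> is the pipe in a marked
  R-tile of \<open>M\<close> and \<open>s\<close> the pipe of \<open>P\<close> at the left edge of that tile, then \<open>q\<close> has already been passed
  in an H-tile by some \<open>s'\<close> in \<open>S\<close> with \<open>q < s'\<close>, and \<open>s' \<le> s\<close> because the labels in \<open>S\<close> increase
  along the word.  Hence \<open>q < s\<close>, and \<open>s\<close> and \<open>q\<close> only touch in this tile, as they should.  At the end,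
  the word of \<open>P\<close> and \<open>inv w\<close> agree outside \<open>S\<close>, and both list the elements of \<open>S\<close> in increasing
  order on the remaining positions; so they are equal.
\<close>

section \<open>The labels produced by the tracing\<close>

definition earlier :: "cell \<Rightarrow> cell \<Rightarrow> bool" where
  "earlier c d \<longleftrightarrow> fst d < fst c \<or> fst c = fst d \<and> snd c < snd d"

lemma earlier_pair [simp]: "earlier (i', j') (i, j) \<longleftrightarrow> i < i' \<or> i' = i \<and> j' < j"
  by (simp add: earlier_def)

lemma set_reading_order: "set (reading_order n) = grid n"
  by (auto simp: reading_order_def grid_def atLeastLessThanSuc_atLeastAtMost simp del: upt_Suc)

lemma sorted_wrt_earlier_rows:
  "sorted_wrt (>) is \<Longrightarrow> sorted_wrt (<) js \<Longrightarrow>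
   sorted_wrt earlier (concat (map (\<lambda>i. map (\<lambda>j. (i, j)) js) is))"
  by (induction "is") (auto simp: sorted_wrt_append sorted_wrt_map)

lemma sorted_reading_order: "sorted_wrt earlier (reading_order n)"
  unfolding reading_order_def
  by (intro sorted_wrt_earlier_rows) (auto simp: sorted_wrt_rev simp del: upt_Suc)

lemma fold_trace_step_other:
  assumes "c \<notin> set xs"
  shows "fst (fold (trace_step T) xs s) c = fst s c"
    and "fst (snd (fold (trace_step T) xs s)) c = fst (snd s) c"
  using assms
  by (induction xs arbitrary: s)
     (auto simp: trace_step_def Let_def case_prod_unfold)

lemma top_pipe_off_grid: "c \<notin> grid n \<Longrightarrow> top_pipe n T c = 0"
  unfolding top_pipe_def trace_def by (subst fold_trace_step_other) (auto simp: set_reading_order)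

text \<open>The set of crossed pairs in the middle of the tracing, read off from the final labels.\<close>

definition crossed :: "nat \<Rightarrow> tiling \<Rightarrow> cell \<Rightarrow> nat set set" where
  "crossed n T c =
     {{left_pipe n T d, bottom_pipe n T d} |d. d \<in> grid n \<and> earlier d c \<and> T d = Cross}"

lemma reading_order_split:
  assumes "reading_order n = xs @ c # ys"
  shows "set xs = {d \<in> grid n. earlier d c}" "\<forall>d\<in>set ys. earlier c d" "c \<in> grid n"
proof -
  have s: "sorted_wrt earlier (xs @ c # ys)" using sorted_reading_order assms by metis
  have g: "grid n = set xs \<union> {c} \<union> set ys" using set_reading_order[of n] assms by auto
  show "\<forall>d\<in>set ys. earlier c d" "c \<in> grid n" using s g by (auto simp: sorted_wrt_append)
  show "set xs = {d \<in> grid n. earlier d c}"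
    using s g by (fastforce simp: sorted_wrt_append earlier_def)
qed

text \<open>
  Each label is written once, and it is written before it is read; so the labels that a step of the
  tracing reads are the final ones.
\<close>

lemma inputs_are_final:
  fixes T :: tiling
  assumes "reading_order n = xs @ c # ys"
  defines "s \<equiv> fold (trace_step T) xs (\<lambda>_. 0, \<lambda>_. 0, {})"
  shows "left_input T (fst s) c = left_pipe n T c"
    and "bottom_input (fst (snd s)) c = bottom_pipe n T c"
proof -
  obtain i j where c: "c = (i, j)" by fastforce
  have tr: "trace n T = fold (trace_step T) (c # ys) s"
    by (simp add: trace_def assms)
  have ij: "i \<ge> 1" "j \<ge> 1" using reading_order_split(3)[OF assms(1)] by (auto simp: c grid_def)
  have nl: "(i, j - 1) \<notin> set (c # ys)" if "j \<noteq> 1"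
    using reading_order_split(2)[OF assms(1)] ij that by (auto simp: c)
  have nb: "(i + 1, j) \<notin> set (c # ys)"
    using reading_order_split(2)[OF assms(1)] by (auto simp: c)
  show "left_input T (fst s) c = left_pipe n T c"
    using fold_trace_step_other(1)[OF nl, of T s]
    by (auto simp: left_pipe_def left_input_def c right_pipe_def tr)
  show "bottom_input (fst (snd s)) c = bottom_pipe n T c"
    using fold_trace_step_other(2)[OF nb, of T s]
    by (auto simp: bottom_pipe_def bottom_input_def c top_pipe_def tr)
qed

lemma crossed_pairs_of_prefix:
  assumes "reading_order n = xs @ ys"
  shows "snd (snd (fold (trace_step T) xs (\<lambda>_. 0, \<lambda>_. 0, {}))) =
    {{left_pipe n T d, bottom_pipe n T d} |d. d \<in> set xs \<and> T d = Cross}"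
  using assms
proof (induction xs arbitrary: ys rule: rev_induct)
  case Nil
  then show ?case by simp
next
  case (snoc c xs)
  have ro: "reading_order n = xs @ c # ys" using snoc.prems by simp
  define s where "s = fold (trace_step T) xs (\<lambda>_. 0, \<lambda>_. 0, {})"
  note inp = inputs_are_final[OF ro, of T, folded s_def]
  have "snd (snd (trace_step T c s)) =
    (if T c = Cross then insert {left_pipe n T c, bottom_pipe n T c} (snd (snd s)) else snd (snd s))"
    by (simp add: trace_step_def Let_def case_prod_unfold inp)
  moreover have "snd (snd s) =
      {{left_pipe n T d, bottom_pipe n T d} |d. d \<in> set xs \<and> T d = Cross}"
    unfolding s_def using snoc.IH[OF ro] .
  ultimately show ?case by (auto simp: s_def simp del: split_paired_Ex)
qed

lemma outputs_labels:
  assumes "c \<in> grid n"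
  shows "outputs (T c) ({left_pipe n T c, bottom_pipe n T c} \<in> crossed n T c)
           (left_pipe n T c) (bottom_pipe n T c) = (right_pipe n T c, top_pipe n T c)"
proof -
  obtain xs ys where ro: "reading_order n = xs @ c # ys"
    using assms set_reading_order by (metis split_list)
  define s where "s = fold (trace_step T) xs (\<lambda>_. 0, \<lambda>_. 0, {})"
  note inp = inputs_are_final[OF ro, of T, folded s_def]
  have X: "snd (snd s) = crossed n T c"
    unfolding s_def crossed_pairs_of_prefix[OF ro] crossed_def reading_order_split(1)[OF ro] by auto
  have tr: "trace n T = fold (trace_step T) ys (trace_step T c s)"
    by (simp add: trace_def ro s_def)
  have c: "c \<notin> set ys" using reading_order_split(2)[OF ro] by (auto simp: earlier_def)
  show ?thesis
    unfolding right_pipe_def top_pipe_def tr fold_trace_step_other[OF c]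
    by (simp add: trace_step_def Let_def case_prod_unfold inp X)
qed

lemma left_pipe_first: "left_pipe n T (i, 1) = (if meets_left (T (i, 1)) then i else 0)"
  by (simp add: left_pipe_def left_input_def)

lemma left_pipe_next: "j \<ge> 1 \<Longrightarrow> left_pipe n T (i, Suc j) = right_pipe n T (i, j)"
  by (simp add: left_pipe_def left_input_def)

lemma bottom_pipe_eq: "bottom_pipe n T (i, j) = top_pipe n T (Suc i, j)"
  by (simp add: bottom_pipe_def bottom_input_def)

text \<open>
  The three cases follow the cursor of the tracing: \<open>Q i j\<close> speaks of the moment before the cell
  \<open>(i, j)\<close> is processed, and \<open>j = Suc n\<close> is the end of row \<open>i\<close>.
\<close>

lemma reading_order_induct [consumes 4, case_names start cell row]:
  assumes "1 \<le> i" "i \<le> n" "1 \<le> j" "j \<le> Suc n"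
    and start: "Q n 1"
    and cell: "\<And>i j. (i, j) \<in> grid n \<Longrightarrow> Q i j \<Longrightarrow> Q i (Suc j)"
    and row: "\<And>i. 1 \<le> i \<Longrightarrow> i < n \<Longrightarrow> Q (Suc i) (Suc n) \<Longrightarrow> Q i 1"
  shows "Q i j"
proof -
  have along: "Q i j" if "Q i 1" "1 \<le> i" "i \<le> n" "1 \<le> j" "j \<le> Suc n" for i j
    using that(4,5,1-3) by (induction j rule: dec_induct) (auto intro: cell simp: grid_def)
  have "Q i 1" using \<open>i \<le> n\<close> \<open>1 \<le> i\<close>
    by (induction i rule: inc_induct) (use start row along in auto)
  then show ?thesis using along assms(1-4) by blast
qed

text \<open>
  The tracing attaches a pipe to an edge exactly if the tile has a strand there, since neighbouring
  tiles match and no pipe enters through the bottom boundary.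
\<close>

lemma labels_meet:
  assumes T: "tiling_of_grid n T" and c: "(i, j) \<in> grid n"
  shows "left_pipe n T (i, j) \<noteq> 0 \<longleftrightarrow> meets_left (T (i, j))"
    and "bottom_pipe n T (i, j) \<noteq> 0 \<longleftrightarrow> meets_bottom (T (i, j))"
    and "right_pipe n T (i, j) \<noteq> 0 \<longleftrightarrow> meets_right (T (i, j))"
    and "top_pipe n T (i, j) \<noteq> 0 \<longleftrightarrow> meets_top (T (i, j))"
proof -
  define Q where "Q c \<longleftrightarrow> (left_pipe n T c \<noteq> 0 \<longleftrightarrow> meets_left (T c)) \<and>
    (bottom_pipe n T c \<noteq> 0 \<longleftrightarrow> meets_bottom (T c)) \<and>
    (right_pipe n T c \<noteq> 0 \<longleftrightarrow> meets_right (T c)) \<and>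
    (top_pipe n T c \<noteq> 0 \<longleftrightarrow> meets_top (T c))" for c
  have out: "(right_pipe n T c \<noteq> 0 \<longleftrightarrow> meets_right (T c)) \<and>
    (top_pipe n T c \<noteq> 0 \<longleftrightarrow> meets_top (T c))"
    if "c \<in> grid n" "left_pipe n T c \<noteq> 0 \<longleftrightarrow> meets_left (T c)"
      "bottom_pipe n T c \<noteq> 0 \<longleftrightarrow> meets_bottom (T c)" for c
    using outputs_labels[OF that(1), of T] that(2,3)
    by (cases "T c")
       (auto simp: meets_left_def meets_right_def meets_top_def meets_bottom_def split: if_splits)
  have IH: "\<forall>d\<in>grid n. earlier d (i, j) \<longrightarrow> Q d"
    if "1 \<le> i" "i \<le> n" "1 \<le> j" "j \<le> Suc n" for i j
    using that
  proof (induction i j rule: reading_order_induct)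
    case start
    then show ?case by (auto simp: grid_def)
  next
    case (cell i j)
    have "left_pipe n T (i, j) \<noteq> 0 \<longleftrightarrow> meets_left (T (i, j))"
    proof (cases "j = 1")
      case True
      then show ?thesis using cell(1) by (auto simp: left_pipe_def left_input_def grid_def)
    next
      case False
      then obtain k where k: "j = Suc k" "k \<ge> 1" using cell(1) by (cases j) (auto simp: grid_def)
      then have "Q (i, k)" using cell by (auto simp: grid_def)
      then show ?thesis using k cell(1) T
        by (auto simp: Q_def left_pipe_next tiling_of_grid_def grid_def)
    qed
    moreover have "bottom_pipe n T (i, j) \<noteq> 0 \<longleftrightarrow> meets_bottom (T (i, j))"
    proof (cases "i = n")
      case True
      then show ?thesis using cell(1) T
        by (auto simp: bottom_pipe_eq grid_def top_pipe_off_grid tiling_of_grid_def)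
    next
      case False
      then have "Q (Suc i, j)" using cell by (auto simp: grid_def)
      then show ?thesis using cell(1) T False
        by (auto simp: Q_def bottom_pipe_eq tiling_of_grid_def grid_def)
    qed
    ultimately have "Q (i, j)" using out cell(1) by (auto simp: Q_def)
    then show ?case using cell(2) by (auto simp: less_Suc_eq)
  next
    case (row i)
    show ?case
    proof (intro ballI impI)
      fix d
      assume "d \<in> grid n" "earlier d (i, 1)"
      then have "earlier d (Suc i, Suc n)" by (cases d) (auto simp: grid_def)
      then show "Q d" using row(3) \<open>d \<in> grid n\<close> by blast
    qed
  qed
  have "Q (i, j)" using IH[of i "Suc j"] c by (auto simp: grid_def)
  then show "left_pipe n T (i, j) \<noteq> 0 \<longleftrightarrow> meets_left (T (i, j))"
    and "bottom_pipe n T (i, j) \<noteq> 0 \<longleftrightarrow> meets_bottom (T (i, j))"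
    and "right_pipe n T (i, j) \<noteq> 0 \<longleftrightarrow> meets_right (T (i, j))"
    and "top_pipe n T (i, j) \<noteq> 0 \<longleftrightarrow> meets_top (T (i, j))"
    by (auto simp: Q_def)
qed

section \<open>Frontier words\<close>

text \<open>
  The pipes on the frontier when the tracing has reached the cell \<open>(i, j)\<close>.  Along the path from the
  top left to the bottom right there are the left edges of the rows above \<open>i\<close>, the top edges of the
  processed cells of row \<open>i\<close>, the left edge of \<open>(i, j)\<close>, and the edges between the rows \<open>i\<close> and \<open>i + 1\<close>
  from column \<open>j\<close> on.  The word is described by the final labels of these edges, so that no second
  tracing has to be defined.  With \<open>j = Suc n\<close> it is the word at the end of row \<open>i\<close>, where the third
  kind of edge is the right boundary.
\<close>

definition word :: "nat \<Rightarrow> tiling \<Rightarrow> nat \<Rightarrow> nat \<Rightarrow> nat \<Rightarrow> nat" where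
  "word n T i j k =
     (if k < i then left_pipe n T (k, 1)
      else if Suc k < i + j then top_pipe n T (i, Suc k - i)
      else if Suc k = i + j then left_pipe n T (i, j)
      else bottom_pipe n T (i, k - i))"

definition swap_next :: "nat \<Rightarrow> (nat \<Rightarrow> 'a) \<Rightarrow> nat \<Rightarrow> 'a" where
  "swap_next a F = F(a := F (Suc a), Suc a := F a)"

lemma swap_next_simps [simp]:
  "swap_next a F a = F (Suc a)"
  "swap_next a F (Suc a) = F a"
  "x \<noteq> a \<Longrightarrow> x \<noteq> Suc a \<Longrightarrow> swap_next a F x = F x"
  by (simp_all add: swap_next_def)

lemma range_swap_next: "range (swap_next a F) = range F"
proof -
  have "swap_next a F = F \<circ> Transposition.transpose a (Suc a)"
    by (auto simp: swap_next_def Transposition.transpose_def)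
  then have "range (swap_next a F) = F ` range (Transposition.transpose a (Suc a))"
    by (simp only: image_comp)
  then show ?thesis using bij_is_surj[OF bij_transpose[of a "Suc a"]] by simp
qed

text \<open>
  Any pair of entries other than the swapped one keeps its relative order, although one of its members
  may move by one position.  The clause on \<open>x' < a\<close> serves to see that a pipe which has left the current
  row through a top edge stays where it is.
\<close>

lemma swap_next_pair:
  assumes "x < y" "\<not> (x = a \<and> y = Suc a)"
  shows "\<exists>x' y'. x' < y' \<and> \<not> (x' = a \<and> y' = Suc a) \<and> (x' < a \<longrightarrow> x' = x) \<and>
    swap_next a F x = F x' \<and> swap_next a F y = F y'"
proof -
  let ?t = "Transposition.transpose a (Suc a)"
  have "swap_next a F z = F (?t z)" for z by (auto simp: swap_next_def Transposition.transpose_def)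
  moreover have "?t x < ?t y" "\<not> (?t x = a \<and> ?t y = Suc a)" "?t x < a \<longrightarrow> ?t x = x"
    using assms by (auto simp: Transposition.transpose_def)
  ultimately show ?thesis by blast
qed

lemma word_here:
  "j \<ge> 1 \<Longrightarrow> word n T i j (i + j - 1) = left_pipe n T (i, j)"
  "j \<ge> 1 \<Longrightarrow> word n T i j (i + j) = bottom_pipe n T (i, j)"
  by (auto simp: word_def)

lemma word_next:
  assumes "j \<ge> 1"
  shows "word n T i (Suc j) = (word n T i j)
    (i + j - 1 := top_pipe n T (i, j), i + j := right_pipe n T (i, j))"
proof
  fix k
  show "word n T i (Suc j) k = ((word n T i j)
    (i + j - 1 := top_pipe n T (i, j), i + j := right_pipe n T (i, j))) k"
    using assms by (auto simp: word_def left_pipe_next)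
qed

lemma right_pipe_boundary:
  assumes "tiling_of_grid n T" "i \<in> {1..n}"
  shows "left_pipe n T (i, Suc n) = 0"
  using assms labels_meet(3)[OF assms(1), of i n] left_pipe_next[of n n T i]
  by (auto simp: grid_def tiling_of_grid_def)

text \<open>
  The edge at the end of a row lies on the right boundary and carries no pipe.  Hence dropping it from
  the path does not change the word.
\<close>

lemma word_row:
  assumes "tiling_of_grid n T" "1 \<le> i" "i < n"
  shows "word n T i 1 = word n T (Suc i) (Suc n)"
proof
  fix k
  show "word n T i 1 k = word n T (Suc i) (Suc n) k"
  proof (cases "k \<le> i + n")
    case True
    then show ?thesis by (auto simp: word_def bottom_pipe_eq less_Suc_eq Suc_diff_le)
  next
    case False
    have "word n T (Suc i) (Suc n) k = 0"
      using False right_pipe_boundary[OF assms(1), of "Suc i"] assms(2,3)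
      by (auto simp: word_def bottom_pipe_eq grid_def intro!: top_pipe_off_grid)
    moreover have "word n T i 1 k = 0"
      using False assms(2,3)
      by (auto simp: word_def bottom_pipe_eq grid_def intro!: top_pipe_off_grid)
    ultimately show ?thesis by simp
  qed
qed

lemma word_start:
  "n \<ge> 1 \<Longrightarrow> word n T n 1 k = (if k \<le> n then left_pipe n T (k, 1) else 0)"
  by (auto simp: word_def bottom_pipe_eq top_pipe_off_grid grid_def)

lemma word_end:
  "1 \<le> k \<Longrightarrow> k \<le> n \<Longrightarrow> word n T 1 (Suc n) k = top_pipe n T (1, k)"
  by (auto simp: word_def)

lemma word_end_outside:
  assumes "tiling_of_grid n T" "k = 0 \<or> n < k" "n \<ge> 1"
  shows "word n T 1 (Suc n) k = 0"
proof -
  have "T (0, 1) = Blank" using assms(1) by (auto simp: tiling_of_grid_def grid_def)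
  then show ?thesis
    using assms right_pipe_boundary[OF assms(1), of 1]
    by (auto simp: word_def left_pipe_first meets_left_def bottom_pipe_eq grid_def
             simp flip: One_nat_def intro!: top_pipe_off_grid)
qed

lemma crossed_start: "crossed n T (n, 1) = {}"
  by (auto simp: crossed_def grid_def)

lemma crossed_next:
  assumes "(i, j) \<in> grid n"
  shows "crossed n T (i, Suc j) = (if T (i, j) = Cross
    then insert {left_pipe n T (i, j), bottom_pipe n T (i, j)} (crossed n T (i, j))
    else crossed n T (i, j))"
proof -
  have "earlier d (i, Suc j) \<longleftrightarrow> d = (i, j) \<or> earlier d (i, j)" for d
    by (cases d) auto
  then show ?thesis using assms unfolding crossed_def by (auto simp del: split_paired_Ex)
qed

lemma crossed_row:
  "crossed n T (i, 1) = crossed n T (Suc i, Suc n)"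
proof -
  have "d \<in> grid n \<and> earlier d (i, 1) \<and> T d = Cross \<longleftrightarrow>
    d \<in> grid n \<and> earlier d (Suc i, Suc n) \<and> T d = Cross" for d
    by (cases d) (auto simp: grid_def)
  then show ?thesis unfolding crossed_def by presburger
qed

text \<open>
  The condition for a cross tile does not mention the history of the tracing.  That this is correct is
  the content of \<open>word_step\<close> below.
\<close>

definition swaps :: "nat \<Rightarrow> tiling \<Rightarrow> cell \<Rightarrow> bool" where
  "swaps n T c \<longleftrightarrow> T c \<in> {HTile, VTile} \<or>
     T c = Cross \<and> left_pipe n T c < bottom_pipe n T c"

text \<open>
  The invariant that links the memory \<open>X\<close> of the tracing to the frontier word \<open>F\<close>; the entries 0 stand
  for the absence of a pipe and are ignored.
\<close>

definition records_inversions :: "nat set set \<Rightarrow> (nat \<Rightarrow> nat) \<Rightarrow> bool" where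
  "records_inversions X F \<longleftrightarrow> (\<forall>x y. x < y \<longrightarrow> F x \<noteq> 0 \<longrightarrow> F y \<noteq> 0 \<longrightarrow>
     F x \<noteq> F y \<and> ({F x, F y} \<in> X \<longleftrightarrow> F y < F x))"

lemma records_inversions_inj:
  assumes "records_inversions X F" "F x = F y" "F x \<noteq> 0"
  shows "x = y"
  using assms unfolding records_inversions_def by (metis linorder_neqE_nat)

lemma records_inversions_slide:
  assumes F: "records_inversions X F" and "F a = 0 \<or> F (Suc a) = 0"
  shows "records_inversions X (swap_next a F)"
  unfolding records_inversions_def
proof (intro allI impI)
  fix x y
  assume xy: "x < y" "swap_next a F x \<noteq> 0" "swap_next a F y \<noteq> 0"
  then have xya: "\<not> (x = a \<and> y = Suc a)" using assms(2) by auto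
  obtain x' y' where "x' < y'" "swap_next a F x = F x'" "swap_next a F y = F y'"
    using swap_next_pair[OF xy(1) xya, of F] by blast
  then show "swap_next a F x \<noteq> swap_next a F y \<and>
    ({swap_next a F x, swap_next a F y} \<in> X \<longleftrightarrow> swap_next a F y < swap_next a F x)"
    using F xy unfolding records_inversions_def by simp
qed

lemma records_inversions_cross:
  assumes F: "records_inversions X F" and "0 < F a" "F a < F (Suc a)"
  shows "records_inversions (insert {F a, F (Suc a)} X) (swap_next a F)"
  unfolding records_inversions_def
proof (intro allI impI)
  fix x y
  assume xy: "x < y" "swap_next a F x \<noteq> 0" "swap_next a F y \<noteq> 0"
  show "swap_next a F x \<noteq> swap_next a F y \<and>
    ({swap_next a F x, swap_next a F y} \<in> insert {F a, F (Suc a)} X \<longleftrightarrow>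
      swap_next a F y < swap_next a F x)"
  proof (cases "x = a \<and> y = Suc a")
    case True
    then show ?thesis using assms by auto
  next
    case False
    obtain x' y' where x'y': "x' < y'" "\<not> (x' = a \<and> y' = Suc a)"
      "swap_next a F x = F x'" "swap_next a F y = F y'"
      using swap_next_pair[OF xy(1) False, of F] by blast
    moreover have "{F x', F y'} \<noteq> {F a, F (Suc a)}"
    proof
      assume "{F x', F y'} = {F a, F (Suc a)}"
      then have "F x' = F a \<and> F y' = F (Suc a) \<or> F x' = F (Suc a) \<and> F y' = F a"
        by (auto simp: doubleton_eq_iff)
      moreover have "F x' \<noteq> 0" "F y' \<noteq> 0" using x'y' xy by auto
      ultimately have "x' = a \<and> y' = Suc a \<or> x' = Suc a \<and> y' = a"
        using records_inversions_inj[OF F] by blast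
      then show False using x'y'(1,2) by auto
    qed
    ultimately show ?thesis using F xy unfolding records_inversions_def by simp
  qed
qed

text \<open>
  Both facts are needed together: the invariant tells whether a cross tile swaps, and the swap
  preserves the invariant.
\<close>

lemma word_step_aux:
  assumes T: "tiling_of_grid n T" and c: "(i, j) \<in> grid n"
    and inv: "records_inversions (crossed n T (i, j)) (word n T i j)"
  shows "word n T i (Suc j) = (if swaps n T (i, j)
    then swap_next (i + j - 1) (word n T i j) else word n T i j)" (is ?step)
    and "records_inversions (crossed n T (i, Suc j)) (word n T i (Suc j))"
proof -
  define W where "W = word n T i j"
  define a where "a = i + j - 1"
  note inv = inv[folded W_def]
  have ij: "i \<ge> 1" "j \<ge> 1" "i + j = Suc a" using c by (auto simp: grid_def a_def)
  have here: "left_pipe n T (i, j) = W a" "bottom_pipe n T (i, j) = W (Suc a)"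
    using word_here[OF ij(2), of n T i] by (simp_all add: W_def ij(3))
  have nz: "W a \<noteq> 0 \<longleftrightarrow> meets_left (T (i, j))" "W (Suc a) \<noteq> 0 \<longleftrightarrow> meets_bottom (T (i, j))"
    using labels_meet[OF T c] here by auto
  have pair: "W a \<noteq> W (Suc a) \<and> ({W a, W (Suc a)} \<in> crossed n T (i, j) \<longleftrightarrow> W (Suc a) < W a)"
    if "T (i, j) = Cross"
    using inv nz that by (auto simp: records_inversions_def meets_left_def meets_bottom_def)
  have "(right_pipe n T (i, j), top_pipe n T (i, j)) =
    (if swaps n T (i, j) then (W a, W (Suc a)) else (W (Suc a), W a))"
    using outputs_labels[OF c, of T] nz pair
    by (cases "T (i, j)") (auto simp: here swaps_def meets_left_def meets_bottom_def)
  then have next_word: "word n T i (Suc j) = (if swaps n T (i, j) then swap_next a W else W)"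
    using word_next[OF ij(2), of n T i]
    by (auto simp: W_def[symmetric] swap_next_def ij(3) split: if_splits)
  then show ?step by (simp add: W_def a_def)
  show "records_inversions (crossed n T (i, Suc j)) (word n T i (Suc j))"
  proof (cases "swaps n T (i, j)")
    case False
    then have "crossed n T (i, Suc j) = crossed n T (i, j)"
      using pair unfolding crossed_next[OF c] by (auto simp: swaps_def here)
    then show ?thesis using False inv by (simp add: next_word)
  next
    case True
    show ?thesis
    proof (cases "T (i, j) = Cross")
      case C: True
      then have "0 < W a" "W a < W (Suc a)"
        using nz True by (auto simp: swaps_def here meets_left_def)
      then show ?thesis
        using records_inversions_cross[OF inv] True C
        by (simp add: next_word crossed_next[OF c] here)
    next
      case False
      then have "W a = 0 \<or> W (Suc a) = 0"
        using True nz by (auto simp: swaps_def meets_left_def meets_bottom_def)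
      then show ?thesis
        using records_inversions_slide[OF inv] True False
        by (simp add: next_word crossed_next[OF c])
    qed
  qed
qed

lemma records_inversions_word:
  assumes T: "tiling_of_grid n T" and "1 \<le> i" "i \<le> n" "1 \<le> j" "j \<le> Suc n"
  shows "records_inversions (crossed n T (i, j)) (word n T i j)"
  using assms(2-5)
proof (induction i j rule: reading_order_induct)
  case start
  then show ?case
    using assms
    unfolding records_inversions_def crossed_start
    by (auto simp: word_start left_pipe_first simp flip: One_nat_def split: if_splits)
next
  case (cell i j)
  then show ?case using word_step_aux(2)[OF T] by blast
next
  case (row i)
  then show ?case using word_row[OF T, of i] crossed_row[of n T i] by simp
qed

lemma word_step:
  assumes "tiling_of_grid n T" "(i, j) \<in> grid n"
  shows "word n T i (Suc j) = (if swaps n T (i, j)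
    then swap_next (i + j - 1) (word n T i j) else word n T i j)"
  using word_step_aux(1)[OF assms] records_inversions_word[OF assms(1)] assms(2)
  by (auto simp: grid_def)

lemma word_inj:
  assumes "tiling_of_grid n T" "1 \<le> i" "i \<le> n" "1 \<le> j" "j \<le> Suc n"
    and "word n T i j x = word n T i j y" "word n T i j x \<noteq> 0"
  shows "x = y"
  using records_inversions_inj[OF records_inversions_word[OF assms(1-5)] assms(6,7)] .

lemma right_pipe_swaps:
  assumes T: "tiling_of_grid n T" and c: "c \<in> grid n"
  shows "right_pipe n T c = (if swaps n T c then left_pipe n T c else bottom_pipe n T c)"
    and "top_pipe n T c = (if swaps n T c then bottom_pipe n T c else left_pipe n T c)"
proof -
  obtain i j where ij: "c = (i, j)" by fastforce
  then have pos: "i \<ge> 1" "j \<ge> 1" using c by (auto simp: grid_def)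
  define a where "a = i + j - 1"
  have a: "i + j = Suc a" using pos by (simp add: a_def)
  have here: "left_pipe n T c = word n T i j a" "bottom_pipe n T c = word n T i j (Suc a)"
    using word_here[OF pos(2), of n T i] by (simp_all add: ij a)
  have "right_pipe n T c = word n T i (Suc j) (Suc a)" "top_pipe n T c = word n T i (Suc j) a"
    using word_next[OF pos(2), of n T i] by (auto simp: ij a)
  then show "right_pipe n T c = (if swaps n T c then left_pipe n T c else bottom_pipe n T c)"
    and "top_pipe n T c = (if swaps n T c then bottom_pipe n T c else left_pipe n T c)"
    using word_step[OF T, of i j] c by (auto simp: here[unfolded ij] ij a)
qed

text \<open>
  Cells only permute the entries of a frontier word.  Hence the pipes that leave at the top are those
  that have entered on the left.
\<close>

lemma range_word:
  assumes T: "tiling_of_grid n T" and "1 \<le> i" "i \<le> n" "1 \<le> j" "j \<le> Suc n"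
  shows "range (word n T i j) = range (word n T n 1)"
  using assms(2-5)
proof (induction i j rule: reading_order_induct)
  case (cell i j)
  then show ?case using word_step[OF T cell(1)] range_swap_next by metis
next
  case (row i)
  then show ?case using word_row[OF T, of i] by simp
qed simp

lemma pipes_that_exit:
  assumes T: "tiling_of_grid n T" and n: "n \<ge> 1"
  shows "{top_pipe n T (1, k) |k. k \<in> {1..n}} - {0} = {k \<in> {1..n}. meets_left (T (k, 1))}"
proof -
  have "range (word n T n 1) - {0} = {k \<in> {1..n}. meets_left (T (k, 1))}"
  proof -
    have off: "\<not> meets_left (T (k, 1))" if "k = 0 \<or> n < k" for k
      using T that by (auto simp: tiling_of_grid_def grid_def meets_left_def)
    have w: "word n T n 1 k = (if k \<in> {1..n} \<and> meets_left (T (k, 1)) then k else 0)" for k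
      using off[of k] by (auto simp: word_start[OF n] left_pipe_first simp del: One_nat_def)
    have "k \<in> range (word n T n 1) - {0} \<longleftrightarrow> k \<in> {1..n} \<and> meets_left (T (k, 1))" for k
    proof
      assume "k \<in> range (word n T n 1) - {0}"
      then obtain l where "k = word n T n 1 l" "k \<noteq> 0" by auto
      then show "k \<in> {1..n} \<and> meets_left (T (k, 1))" using w[of l] by presburger
    next
      assume k: "k \<in> {1..n} \<and> meets_left (T (k, 1))"
      then have "word n T n 1 k = k" using w[of k] by presburger
      then have "k \<in> range (word n T n 1)" by (metis rangeI)
      then show "k \<in> range (word n T n 1) - {0}" using k by auto
    qed
    then show ?thesis by blast
  qed
  moreover have "range (word n T 1 (Suc n)) - {0} = {top_pipe n T (1, k) |k. k \<in> {1..n}} - {0}"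
  proof -
    have "word n T 1 (Suc n) k = (if k \<in> {1..n} then top_pipe n T (1, k) else 0)" for k
      using word_end[of k n T] word_end_outside[OF T _ n, of k] by auto
    then show ?thesis by (auto simp: image_def split: if_splits)
  qed
  ultimately show ?thesis using range_word[OF T, of 1 "Suc n"] n by simp
qed

section \<open>The staircase\<close>

lemma bottom_right: "t \<noteq> VTile \<Longrightarrow> meets_bottom t \<Longrightarrow> meets_right t"
  by (cases t) (auto simp: meets_bottom_def meets_right_def)

text \<open>
  A tile other than the vertical one has a strand at its right edge if it has one at its bottom edge.
  Going from the right boundary to the left, column \<open>j\<close> therefore has no strand at a bottom edge from row
  \<open>n + 1 - j\<close> on, and is blank from the row after that.
\<close>

lemma staircase:
  assumes T: "tiling_of_grid n T" and V: "\<forall>c. T c \<noteq> VTile" and c: "(i, j) \<in> grid n"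
  shows "n < i + j \<Longrightarrow> T (i, j) \<in> {JTile, Blank}"
    and "Suc n < i + j \<Longrightarrow> T (i, j) = Blank"
proof -
  have blank: "T (i, j) = Blank"
    if "Suc n < i + j" "i \<in> {1..n}" "j \<in> {1..n}"
      "\<forall>i\<in>{1..n}. n < i + j \<longrightarrow> \<not> meets_right (T (i, j))" for i j
  proof -
    define k where "k = i - 1"
    have k: "i = Suc k" "k \<in> {1..<n}" using that(1-3) by (auto simp: k_def)
    have "\<not> meets_right (T (k, j))" "\<not> meets_right (T (i, j))" using that k by auto
    then have "\<not> meets_bottom (T (k, j))" "\<not> meets_bottom (T (i, j))" "\<not> meets_right (T (i, j))"
      using V bottom_right by blast+
    moreover from this have "\<not> meets_top (T (i, j))"
      using T k that(3) by (auto simp: tiling_of_grid_def)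
    ultimately show ?thesis
      by (cases "T (i, j)") (auto simp: meets_bottom_def meets_right_def meets_top_def)
  qed
  have right: "\<forall>i\<in>{1..n}. n < i + j \<longrightarrow> \<not> meets_right (T (i, j))" if "j \<le> n" "1 \<le> j" for j
    using that
  proof (induction j rule: inc_induct)
    case base
    then show ?case using T by (auto simp: tiling_of_grid_def)
  next
    case (step j)
    show ?case
    proof (intro ballI impI)
      fix i assume i: "i \<in> {1..n}" "n < i + j"
      then have "T (i, Suc j) = Blank" using blank[of i "Suc j"] step by simp
      moreover have "meets_right (T (i, j)) \<longleftrightarrow> meets_left (T (i, Suc j))"
        using T i step.hyps step.prems by (simp add: tiling_of_grid_def)
      ultimately show "\<not> meets_right (T (i, j))" by (simp add: meets_left_def)
    qed
  qed
  show "T (i, j) = Blank" if "Suc n < i + j"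
    using blank[OF that] right c by (auto simp: grid_def)
  show "T (i, j) \<in> {JTile, Blank}" if "n < i + j"
  proof -
    have "\<not> meets_right (T (i, j))" using right[of j] that c by (auto simp: grid_def)
    then show ?thesis using V by (cases "T (i, j)") (auto simp: meets_right_def)
  qed
qed

definition pipe_dream_of :: "nat \<Rightarrow> cell set \<Rightarrow> tiling" where
  "pipe_dream_of n C = (\<lambda>(i, j).
     if (i, j) \<notin> grid n \<or> Suc n < i + j then Blank
     else if i + j = Suc n then JTile
     else if (i, j) \<in> C then Cross else Bump)"

lemma pipe_dream_pipe_dream_of: "pipe_dream n (pipe_dream_of n C)"
  unfolding pipe_dream_def tiling_of_grid_def pipe_dream_of_def
  by (auto simp: grid_def meets_left_def meets_right_def meets_top_def meets_bottom_def)

text \<open>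
  All columns have a pipe at the top.  In row \<open>i\<close> the strands at the top edges of the columns up to
  \<open>n + 1 - i\<close> force strands at the left edges, hence at the right edges of the preceding tiles, which
  therefore are cross or bump tiles and pass the strands at top edges on to row \<open>i + 1\<close>.
\<close>

lemma pipe_dream_eq:
  assumes "pipe_dream n P"
  shows "P = pipe_dream_of n (wty_PD n P)"
proof
  fix c :: cell
  have T: "tiling_of_grid n P" and tiles: "\<And>c. c \<in> grid n \<Longrightarrow> P c \<in> {Cross, Bump, JTile, Blank}"
    using assms by (auto simp: pipe_dream_def)
  have off: "P c = Blank" if "c \<notin> grid n" for c
    using T that unfolding tiling_of_grid_def by blast
  have V: "\<forall>c. P c \<noteq> VTile" using tiles off by (metis empty_iff insertE tile.distinct)
  have top: "\<forall>j\<in>{1..n}. i + j \<le> Suc n \<longrightarrow> meets_top (P (i, j)) \<and>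
    (i + j \<le> n \<longrightarrow> P (i, j) \<in> {Cross, Bump})" if "1 \<le> i" "i \<le> n" for i
    using that
  proof (induction i rule: dec_induct)
    case base
    have tp: "meets_top (P (1, j))" if "j \<in> {1..n}" for j
      using assms that by (auto simp: pipe_dream_def)
    have "P (1, j) \<in> {Cross, Bump}" if "j \<in> {1..n}" "1 + j \<le> n" for j
    proof -
      have "meets_left (P (1, Suc j))"
        using tp[of "Suc j"] tiles[of "(1, Suc j)"] that
        by (auto simp: grid_def meets_top_def meets_left_def)
      then have "meets_right (P (1, j))"
        using T that by (auto simp: tiling_of_grid_def)
      then show ?thesis using tiles[of "(1, j)"] that by (auto simp: grid_def meets_right_def)
    qed
    then show ?case using tp by blast
  next
    case (step i)
    have tp: "meets_top (P (Suc i, j))" if "j \<in> {1..n}" "Suc i + j \<le> Suc n" for j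
    proof -
      have "P (i, j) \<in> {Cross, Bump}" using step that by simp
      then have "meets_bottom (P (i, j))" by (auto simp: meets_bottom_def)
      then show ?thesis using T that step by (auto simp: tiling_of_grid_def)
    qed
    have "P (Suc i, j) \<in> {Cross, Bump}" if "j \<in> {1..n}" "Suc i + j \<le> n" for j
    proof -
      have "meets_left (P (Suc i, Suc j))"
        using tp[of "Suc j"] tiles[of "(Suc i, Suc j)"] that step
        by (auto simp: grid_def meets_top_def meets_left_def)
      then have "meets_right (P (Suc i, j))"
        using T that step by (auto simp: tiling_of_grid_def)
      then show ?thesis using tiles[of "(Suc i, j)"] that step by (auto simp: grid_def meets_right_def)
    qed
    then show ?case using tp by blast
  qed
  obtain i j where c: "c = (i, j)" by fastforce
  consider "c \<notin> grid n" | "c \<in> grid n" "Suc n < i + j" | "c \<in> grid n" "i + j = Suc n"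
    | "c \<in> grid n" "i + j \<le> n" by linarith
  then show "P c = pipe_dream_of n (wty_PD n P) c"
  proof cases
    case 1
    then show ?thesis using off by (auto simp: pipe_dream_of_def c)
  next
    case 2
    then show ?thesis using staircase(2)[OF T V] by (auto simp: pipe_dream_of_def c)
  next
    case 3
    then have "meets_top (P c)" using top[of i] by (auto simp: c grid_def)
    moreover have "P c \<in> {JTile, Blank}" using staircase(1)[OF T V, of i j] 3 by (auto simp: c)
    ultimately show ?thesis using 3 by (auto simp: pipe_dream_of_def c meets_top_def)
  next
    case 4
    then have "P c \<in> {Cross, Bump}" using top[of i] by (auto simp: c grid_def)
    then show ?thesis using 4 by (auto simp: pipe_dream_of_def c wty_PD_def)
  qed
qed

section \<open>Inversions\<close>

lemma reading_order_induct_rev [consumes 4, case_names finish cell row]: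
  assumes "1 \<le> i" "i \<le> n" "1 \<le> j" "j \<le> Suc n"
    and finish: "Q 1 (Suc n)"
    and cell: "\<And>i j. (i, j) \<in> grid n \<Longrightarrow> Q i (Suc j) \<Longrightarrow> Q i j"
    and row: "\<And>i. 1 \<le> i \<Longrightarrow> i < n \<Longrightarrow> Q i 1 \<Longrightarrow> Q (Suc i) (Suc n)"
  shows "Q i j"
proof -
  have along: "Q i j" if "Q i (Suc n)" "1 \<le> i" "i \<le> n" "1 \<le> j" "j \<le> Suc n" for i j
    using that(5,4,1-3) by (induction j rule: inc_induct) (auto intro: cell simp: grid_def)
  have "Q i (Suc n)" using \<open>1 \<le> i\<close> \<open>i \<le> n\<close>
    by (induction i rule: dec_induct) (use finish row along in auto)
  then show ?thesis using along assms(1-4) by blast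
qed

lemma swap_next_twice [simp]: "swap_next a (swap_next a F) = F"
  by (auto simp: swap_next_def)

lemma swaps_positive:
  assumes T: "tiling_of_grid n T" and c: "c \<in> grid n" and "swaps n T c"
    "left_pipe n T c \<noteq> 0" "bottom_pipe n T c \<noteq> 0"
  shows "T c = Cross" "left_pipe n T c < bottom_pipe n T c"
  using assms labels_meet(1,2)[OF T, of "fst c" "snd c"]
  by (auto simp: swaps_def meets_left_def meets_bottom_def)

text \<open>
  Two pipes are swapped only at an ascent, so a swap creates an inversion and cannot undo one.
\<close>

lemma inversion_persists:
  assumes T: "tiling_of_grid n T" and c: "(i, j) \<in> grid n"
    and xy: "x < y" "word n T i j y < word n T i j x" "word n T i j y \<noteq> 0"
  shows "\<exists>x' y'. x' < y' \<and> word n T i (Suc j) x' = word n T i j x \<and>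
    word n T i (Suc j) y' = word n T i j y"
proof (cases "swaps n T (i, j)")
  case False
  then show ?thesis using word_step[OF T c] xy by auto
next
  case True
  define W where "W = word n T i j"
  define a where "a = i + j - 1"
  have ij: "i \<ge> 1" "j \<ge> 1" "i + j = Suc a" using c by (auto simp: grid_def a_def)
  have here: "left_pipe n T (i, j) = W a" "bottom_pipe n T (i, j) = W (Suc a)"
    using word_here[OF ij(2), of n T i] by (simp_all add: W_def ij(3))
  have "\<not> (x = a \<and> y = Suc a)"
    using swaps_positive[OF T c True] xy by (auto simp: here simp flip: W_def)
  then show ?thesis
    using swap_next_pair[OF xy(1), of a "swap_next a W"] word_step[OF T c] True
    unfolding W_def a_def by (metis swap_next_twice)
qed

text \<open>
  An inversion has been created by a swap in a cross tile.  The alternative \<open>Suc x < i + j\<close> covers a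
  swap in the current row \<open>i\<close>: the larger pipe then has left that row through a top edge, so its
  position \<open>x\<close> is before the cursor.  For \<open>Suc x = i + j\<close>, when the larger pipe is about to enter the cell
  \<open>(i, j)\<close> from the left, the swap thus lies strictly below row \<open>i\<close>, which is what the mark on an
  R-tile asks for.
\<close>

lemma inversion_origin:
  assumes T: "tiling_of_grid n T" and "1 \<le> i" "i \<le> n" "1 \<le> j" "j \<le> Suc n"
    and "x < y" "word n T i j y < word n T i j x" "word n T i j y \<noteq> 0"
  shows "\<exists>i' j'. (i', j') \<in> grid n \<and> (i < i' \<or> i' = i \<and> Suc x < i + j) \<and> T (i', j') = Cross \<and>
    left_pipe n T (i', j') = word n T i j y \<and> bottom_pipe n T (i', j') = word n T i j x"
  using assms(2-)
proof (induction i j arbitrary: x y rule: reading_order_induct)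
  case start
  have "n \<ge> 1" using assms by simp
  from start show ?case
    by (auto simp: word_start[OF \<open>n \<ge> 1\<close>] left_pipe_first simp flip: One_nat_def split: if_splits)
next
  case (cell i j)
  define W where "W = word n T i j"
  define a where "a = i + j - 1"
  note c = \<open>(i, j) \<in> grid n\<close>
  have ij: "i \<ge> 1" "j \<ge> 1" "i + j = Suc a" using c by (auto simp: grid_def a_def)
  have here: "left_pipe n T (i, j) = W a" "bottom_pipe n T (i, j) = W (Suc a)"
    using word_here[OF ij(2), of n T i] by (simp_all add: W_def ij(3))
  have step: "word n T i (Suc j) = (if swaps n T (i, j) then swap_next a W else W)"
    using word_step[OF T c] by (simp add: W_def a_def)
  note IH = cell(2)[folded W_def, unfolded ij(3)]
  show ?case
  proof (cases "swaps n T (i, j)")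
    case False
    then show ?thesis using IH[OF cell(3)] cell(4,5) ij by (force simp: step)
  next
    case True
    note xy = cell(3-5)[unfolded step if_P[OF True]]
    show ?thesis
    proof (cases "x = a \<and> y = Suc a")
      case t: True
      then have "T (i, j) = Cross" using swaps_positive[OF T c True] xy by (auto simp: here)
      then show ?thesis using t c True ij by (intro exI[of _ i] exI[of _ j]) (auto simp: here step)
    next
      case False
      then obtain x' y' where x': "x' < y'" "x' < a \<longrightarrow> x' = x"
        "swap_next a W x = W x'" "swap_next a W y = W y'"
        using swap_next_pair[OF xy(1), of a W] by blast
      then show ?thesis using IH[of x' y'] xy True ij by (fastforce simp: step)
    qed
  qed
next
  case (row i)
  note r = word_row[OF T \<open>1 \<le> i\<close> \<open>i < n\<close>]
  show ?case using row(3)[OF row(4)] row(5,6) unfolding r by (metis Suc_lessD lessI)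
qed

section \<open>Removing pipes\<close>

definition erase :: "nat set \<Rightarrow> nat \<Rightarrow> nat" where
  "erase S v = (if v \<in> S then 0 else v)"

text \<open>
  A removal deletes whole strands, so an edge of the remaining tile is met exactly if its pipe is
  kept.
\<close>

lemma remove_pipes_meets:
  assumes T: "tiling_of_grid n T" and c: "c \<in> grid n"
  shows "meets_left (remove_pipes n S T c) \<longleftrightarrow> erase S (left_pipe n T c) \<noteq> 0"
    and "meets_bottom (remove_pipes n S T c) \<longleftrightarrow> erase S (bottom_pipe n T c) \<noteq> 0"
    and "meets_right (remove_pipes n S T c) \<longleftrightarrow> erase S (right_pipe n T c) \<noteq> 0"
    and "meets_top (remove_pipes n S T c) \<longleftrightarrow> erase S (top_pipe n T c) \<noteq> 0"
proof -
  note lab = labels_meet[OF T, of "fst c" "snd c", simplified, OF c]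
  note sw = right_pipe_swaps[OF T c]
  have "(meets_left (remove_pipes n S T c) \<longleftrightarrow> erase S (left_pipe n T c) \<noteq> 0) \<and>
    (meets_bottom (remove_pipes n S T c) \<longleftrightarrow> erase S (bottom_pipe n T c) \<noteq> 0) \<and>
    (meets_right (remove_pipes n S T c) \<longleftrightarrow> erase S (right_pipe n T c) \<noteq> 0) \<and>
    (meets_top (remove_pipes n S T c) \<longleftrightarrow> erase S (top_pipe n T c) \<noteq> 0)"
  proof (cases "T c = Cross")
    case True
    then have "rest_of_tile Cross (right_pipe n T c = left_pipe n T c) k m =
      (if right_pipe n T c = left_pipe n T c then rest_of_tile Cross True k m
       else rest_of_tile Cross False k m)" for k m by auto
    then show ?thesis using True lab sw
      by (auto simp: remove_pipes_def erase_def meets_left_def meets_right_def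
            meets_top_def meets_bottom_def split: if_splits)
  next
    case False
    then show ?thesis using lab sw
      by (cases "T c") (auto simp: remove_pipes_def erase_def swaps_def meets_left_def
            meets_right_def meets_top_def meets_bottom_def split: if_splits)
  qed
  then show "meets_left (remove_pipes n S T c) \<longleftrightarrow> erase S (left_pipe n T c) \<noteq> 0"
    and "meets_bottom (remove_pipes n S T c) \<longleftrightarrow> erase S (bottom_pipe n T c) \<noteq> 0"
    and "meets_right (remove_pipes n S T c) \<longleftrightarrow> erase S (right_pipe n T c) \<noteq> 0"
    and "meets_top (remove_pipes n S T c) \<longleftrightarrow> erase S (top_pipe n T c) \<noteq> 0"
    by blast+
qed

lemma remove_pipes_off_grid:
  assumes "tiling_of_grid n T" "c \<notin> grid n"
  shows "remove_pipes n S T c = Blank"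
proof -
  have "T c = Blank" using assms unfolding tiling_of_grid_def by blast
  then show ?thesis by (simp add: remove_pipes_def)
qed

lemma tiling_of_grid_remove_pipes:
  assumes T: "tiling_of_grid n T"
  shows "tiling_of_grid n (remove_pipes n S T)"
  unfolding tiling_of_grid_def
proof (intro conjI ballI allI impI)
  show "remove_pipes n S T c = Blank" if "c \<notin> grid n" for c
    using remove_pipes_off_grid[OF T that] .
  show "meets_right (remove_pipes n S T (i, j)) \<longleftrightarrow> meets_left (remove_pipes n S T (i, j + 1))"
    if "i \<in> {1..n}" "j \<in> {1..<n}" for i j
    using that remove_pipes_meets(1)[OF T, of "(i, j + 1)"] remove_pipes_meets(3)[OF T, of "(i, j)"]
    by (auto simp: grid_def left_pipe_next)
  show "meets_bottom (remove_pipes n S T (i, j)) \<longleftrightarrow> meets_top (remove_pipes n S T (i + 1, j))"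
    if "i \<in> {1..<n}" "j \<in> {1..n}" for i j
    using that remove_pipes_meets(4)[OF T, of "(i + 1, j)"] remove_pipes_meets(2)[OF T, of "(i, j)"]
    by (auto simp: grid_def bottom_pipe_eq)
  show "\<not> meets_right (remove_pipes n S T (i, n))" if "i \<in> {1..n}" for i
    using that remove_pipes_meets(3)[OF T, of "(i, n)"] right_pipe_boundary[OF T that]
      left_pipe_next[of n n T i]
    by (auto simp: grid_def erase_def)
  show "\<not> meets_bottom (remove_pipes n S T (n, j))" if "j \<in> {1..n}" for j
    using that remove_pipes_meets(2)[OF T, of "(n, j)"]
    by (auto simp: grid_def erase_def bottom_pipe_eq top_pipe_off_grid)
qed

text \<open>
  In other words, the entries in \<open>S\<close> are left-to-right maxima of all frontier words.
\<close>

definition never_overtaken :: "nat \<Rightarrow> nat set \<Rightarrow> tiling \<Rightarrow> bool" where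
  "never_overtaken n S T \<longleftrightarrow> (\<forall>i\<in>{1..n}. \<forall>j\<in>{1..Suc n}. \<forall>x y. x < y \<longrightarrow>
     word n T i j y < word n T i j x \<longrightarrow> word n T i j y \<noteq> 0 \<longrightarrow> word n T i j y \<notin> S)"

lemma never_overtakenD:
  assumes "never_overtaken n S T" "i \<in> {1..n}" "j \<in> {1..Suc n}" "x < y"
    "word n T i j y < word n T i j x" "word n T i j y \<noteq> 0"
  shows "word n T i j y \<notin> S"
  using assms unfolding never_overtaken_def by blast

text \<open>
  Since inversions persist, it is enough to look at the last frontier word.  This is where
  left-to-right maxima enter.
\<close>

lemma never_overtakenI:
  assumes T: "tiling_of_grid n T"
    and top: "\<And>x y. 1 \<le> x \<Longrightarrow> x < y \<Longrightarrow> y \<le> n \<Longrightarrow>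
      top_pipe n T (1, y) < top_pipe n T (1, x) \<Longrightarrow> top_pipe n T (1, y) \<notin> S"
  shows "never_overtaken n S T"
  unfolding never_overtaken_def
proof (intro ballI)
  fix i j assume "i \<in> {1..n}" "j \<in> {1..Suc n}"
  then have "1 \<le> i" "i \<le> n" "1 \<le> j" "j \<le> Suc n" by auto
  then show "\<forall>x y. x < y \<longrightarrow> word n T i j y < word n T i j x \<longrightarrow> word n T i j y \<noteq> 0 \<longrightarrow>
    word n T i j y \<notin> S"
  proof (induction i j rule: reading_order_induct_rev)
    case finish
    have n: "n \<ge> 1" using \<open>i \<in> {1..n}\<close> by simp
    show ?case
    proof (intro allI impI)
      fix x y
      assume xy: "x < y" "word n T 1 (Suc n) y < word n T 1 (Suc n) x" "word n T 1 (Suc n) y \<noteq> 0"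
      have "k \<noteq> 0 \<and> k \<le> n" if "word n T 1 (Suc n) k \<noteq> 0" for k
        using word_end_outside[OF T _ n, of k] that by force
      then have k: "1 \<le> x" "y \<le> n" using xy by (auto simp: Suc_le_eq)
      then show "word n T 1 (Suc n) y \<notin> S"
        using top[of x y] xy word_end[of x n T] word_end[of y n T] by simp
    qed
  next
    case (cell i j)
    show ?case
    proof (intro allI impI)
      fix x y
      assume xy: "x < y" "word n T i j y < word n T i j x" "word n T i j y \<noteq> 0"
      then obtain x' y' where "x' < y'" "word n T i (Suc j) x' = word n T i j x"
          "word n T i (Suc j) y' = word n T i j y"
        using inversion_persists[OF T cell(1) xy] by blast
      then show "word n T i j y \<notin> S" using cell(2) xy by metis
    qed
  next
    case (row i)
    then show ?case using word_row[OF T row(1,2)] by simp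
  qed
qed

text \<open>
  After a cross tile its two pipes form an inversion, with the larger pipe leaving through the top.
  Therefore the smaller one is not in \<open>S\<close>.
\<close>

lemma cross_never_overtaken:
  assumes T: "tiling_of_grid n T" and S: "never_overtaken n S T"
    and c: "c \<in> grid n" and cross: "T c = Cross"
  shows "left_pipe n T c < bottom_pipe n T c \<Longrightarrow> left_pipe n T c \<notin> S"
    and "bottom_pipe n T c < left_pipe n T c \<Longrightarrow> bottom_pipe n T c \<notin> S"
    and "left_pipe n T c \<noteq> 0" "bottom_pipe n T c \<noteq> 0" "left_pipe n T c \<noteq> bottom_pipe n T c"
proof -
  obtain i j where ij: "c = (i, j)" by fastforce
  then have pos: "i \<in> {1..n}" "j \<in> {1..n}" using c by (auto simp: grid_def)
  define a where "a = i + j - 1"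
  have a: "i + j = Suc a" "j \<ge> 1" using pos by (auto simp: a_def)
  have here: "left_pipe n T c = word n T i j a" "bottom_pipe n T c = word n T i j (Suc a)"
    using word_here[OF a(2), of n T i] by (simp_all add: ij a)
  show nz: "left_pipe n T c \<noteq> 0" "bottom_pipe n T c \<noteq> 0"
    using labels_meet(1,2)[OF T, of i j] c cross
    by (auto simp: ij meets_left_def meets_bottom_def)
  show "left_pipe n T c \<noteq> bottom_pipe n T c"
    using word_inj[OF T, of i j a "Suc a"] nz(1) pos by (auto simp: here)
  have next_labels: "right_pipe n T c = word n T i (Suc j) (Suc a)"
    "top_pipe n T c = word n T i (Suc j) a"
    using word_next[OF a(2), of n T i] by (auto simp: ij a)
  show "bottom_pipe n T c \<notin> S" if "bottom_pipe n T c < left_pipe n T c"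
    using never_overtakenD[OF S, of i j a "Suc a"] that nz pos by (simp add: here)
  show "left_pipe n T c \<notin> S" if "left_pipe n T c < bottom_pipe n T c"
  proof -
    have "swaps n T c" using cross that by (simp add: swaps_def)
    then have "right_pipe n T c = left_pipe n T c" "top_pipe n T c = bottom_pipe n T c"
      using right_pipe_swaps[OF T c] by simp_all
    moreover have "word n T i (Suc j) (Suc a) \<notin> S"
      if "word n T i (Suc j) (Suc a) < word n T i (Suc j) a" "word n T i (Suc j) (Suc a) \<noteq> 0"
      using never_overtakenD[OF S, of i "Suc j" a "Suc a"] pos that by simp
    ultimately show ?thesis using that nz next_labels by simp
  qed
qed

lemma remove_pipes_cross:
  assumes T: "tiling_of_grid n T" and S: "never_overtaken n S T"
    and c: "c \<in> grid n" and cross: "T c = Cross"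
  shows "remove_pipes n S T c =
    (if left_pipe n T c < bottom_pipe n T c
     then if bottom_pipe n T c \<in> S then HTile else Cross
     else if left_pipe n T c \<in> S then MarkedR else Cross)"
proof (cases "left_pipe n T c < bottom_pipe n T c")
  case True
  then have "swaps n T c" using cross by (simp add: swaps_def)
  then have "(right_pipe n T c = left_pipe n T c) = True" using right_pipe_swaps[OF T c] by simp
  then show ?thesis
    using True cross_never_overtaken(1)[OF assms True] by (simp only: remove_pipes_def cross) simp
next
  case False
  then have "\<not> swaps n T c" using cross by (simp add: swaps_def)
  then have r: "(right_pipe n T c = left_pipe n T c) = False"
    using right_pipe_swaps[OF T c] cross_never_overtaken(5)[OF assms] by simp
  have "bottom_pipe n T c < left_pipe n T c"
    using False cross_never_overtaken(5)[OF assms] by simp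
  then show ?thesis
    using False cross_never_overtaken(2)[OF assms] by (simp only: remove_pipes_def cross r) simp
qed

lemma erase_0 [simp]: "erase S 0 = 0"
  by (simp add: erase_def)

text \<open>
  A cell swaps after the removal exactly if it did before: a cross tile that really crosses becomes
  an H-tile or stays a cross tile, and both still swap; one that only touches becomes a marked R-tile
  or stays a cross tile at a descent, and neither swaps.
\<close>

lemma word_remove_pipes:
  assumes T: "tiling_of_grid n T" and tiles: "\<And>c. T c \<in> {Cross, Bump, JTile, Blank}"
    and S: "never_overtaken n S T"
    and "1 \<le> i" "i \<le> n" "1 \<le> j" "j \<le> Suc n"
  shows "word n (remove_pipes n S T) i j = erase S \<circ> word n T i j"
  using assms(4-7)
proof (induction i j rule: reading_order_induct)
  case start
  have n: "n \<ge> 1" using assms(4,5) by simp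
  have "left_pipe n (remove_pipes n S T) (k, 1) = erase S (left_pipe n T (k, 1))" if "k \<le> n" for k
  proof (cases "k = 0")
    case True
    then show ?thesis by (simp add: left_pipe_first del: One_nat_def)
  next
    case False
    then have k: "(k, 1) \<in> grid n" using that n by (simp add: grid_def)
    show ?thesis
      unfolding left_pipe_first remove_pipes_meets(1)[OF T k]
      by (auto simp: erase_def)
  qed
  then show ?case by (auto simp: word_start[OF n] simp del: One_nat_def)
next
  case (cell i j)
  let ?M = "remove_pipes n S T"
  note c = \<open>(i, j) \<in> grid n\<close>
  define a where "a = i + j - 1"
  have ij: "i \<ge> 1" "j \<ge> 1" "i + j = Suc a" using c by (auto simp: grid_def a_def)
  define W where "W = word n T i j"
  have here: "left_pipe n T (i, j) = W a" "bottom_pipe n T (i, j) = W (Suc a)"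
    using word_here[OF ij(2), of n T i] by (simp_all add: W_def ij(3))
  have hereM: "left_pipe n ?M (i, j) = erase S (W a)" "bottom_pipe n ?M (i, j) = erase S (W (Suc a))"
    using word_here[OF ij(2), of n ?M i] cell(2) by (simp_all add: W_def ij(3))
  have "swaps n ?M (i, j) \<longleftrightarrow> swaps n T (i, j)"
  proof (cases "T (i, j) = Cross")
    case True
    note x = cross_never_overtaken[OF T S c True] remove_pipes_cross[OF T S c True]
    show ?thesis using x True by (auto simp: swaps_def here hereM erase_def)
  next
    case False
    then have "?M (i, j) \<notin> {HTile, VTile, Cross}" using tiles[of "(i, j)"]
      by (auto simp: remove_pipes_def split: if_splits)
    then show ?thesis using False tiles[of "(i, j)"] by (auto simp: swaps_def)
  qed
  then show ?case
    using word_step[OF T c] word_step[OF tiling_of_grid_remove_pipes[OF T] c] cell(2)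
    by (auto simp: swap_next_def)
next
  case (row i)
  then show ?case
    using word_row[OF T, of i] word_row[OF tiling_of_grid_remove_pipes[OF T], of i S] by simp
qed

lemma tiles_of_PD:
  assumes "pipe_dream n P"
  shows "tiling_of_grid n P" "P c \<in> {Cross, Bump, JTile, Blank}"
proof -
  show T: "tiling_of_grid n P" using assms by (simp add: pipe_dream_def)
  show "P c \<in> {Cross, Bump, JTile, Blank}"
  proof (cases "c \<in> grid n")
    case True
    then show ?thesis using assms by (auto simp: pipe_dream_def)
  next
    case False
    then have "P c = Blank" using T unfolding tiling_of_grid_def by blast
    then show ?thesis by simp
  qed
qed

lemma permutes_LR_maximum:
  assumes "u permutes {1..n}" "1 \<le> x" "x < y" "y \<le> n" "u y < u x"
  shows "u y \<notin> left_to_right_maxima n u"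
proof
  assume "u y \<in> left_to_right_maxima n u"
  then obtain k where k: "u y = u k" "\<forall>j\<in>{1..<k}. u j < u k"
    unfolding left_to_right_maxima_def by blast
  then have "k = y" using permutes_inj[OF assms(1)] by (metis injD)
  then show False using k(2) assms(2,3,5) by (meson atLeastLessThan_iff order_less_asym)
qed

text \<open>
  The weight is preserved because a cross tile never loses its smaller pipe, which is the one that
  goes on as the strand of an H-tile or of a marked R-tile.
\<close>

lemma wty_Phi:
  assumes w: "w permutes {1..n}" and P: "P \<in> PD n w"
  shows "never_overtaken n (left_to_right_maxima n (inv w)) P" "wty_MVPD n (Phi n w P) = wty_PD n P"
proof -
  have pd: "pipe_dream n P" and top: "\<And>c. c \<in> {1..n} \<Longrightarrow> top_pipe n P (1, c) = inv w c"
    using P by (auto simp: PD_def)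
  note T = tiles_of_PD(1)[OF pd]
  show S: "never_overtaken n (left_to_right_maxima n (inv w)) P"
    by (rule never_overtakenI[OF T])
       (use permutes_LR_maximum[OF permutes_inv[OF w]] top in auto)
  have "c \<in> wty_MVPD n (Phi n w P) \<longleftrightarrow> c \<in> wty_PD n P" if c: "c \<in> grid n" for c
  proof (cases "P c = Cross")
    case True
    then show ?thesis using remove_pipes_cross[OF T S c True] c
      by (auto simp: Phi_def wty_MVPD_def wty_PD_def)
  next
    case False
    then show ?thesis using tiles_of_PD(2)[OF pd, of c]
      by (auto simp: Phi_def wty_MVPD_def wty_PD_def remove_pipes_def split: if_splits)
  qed
  then show "wty_MVPD n (Phi n w P) = wty_PD n P"
    by (auto simp: wty_MVPD_def wty_PD_def)
qed

lemma unmark_meets [simp]: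
  "meets_left (unmark t) = meets_left t" "meets_right (unmark t) = meets_right t"
  "meets_top (unmark t) = meets_top t" "meets_bottom (unmark t) = meets_bottom t"
  "unmark t = Blank \<longleftrightarrow> t = Blank"
  by (cases t; simp add: meets_left_def meets_right_def meets_top_def meets_bottom_def)+

lemma vertical_less_iff:
  "vertical_less_pipe_dream n (unmark \<circ> M) \<longleftrightarrow> tiling_of_grid n M \<and> (\<forall>c. M c \<noteq> VTile)"
proof -
  have a: "tiling_of_grid n (unmark \<circ> M) \<longleftrightarrow> tiling_of_grid n M"
    by (simp add: tiling_of_grid_def)
  have b: "unmark t \<in> {Blank, HTile, Cross, JTile, RTile, Bump} \<longleftrightarrow> t \<noteq> VTile" for t
    by (cases t) auto
  have c: "M c \<noteq> VTile" if "tiling_of_grid n M" "c \<notin> grid n" for c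
  proof -
    have "M c = Blank" using that unfolding tiling_of_grid_def by blast
    then show ?thesis by simp
  qed
  show ?thesis unfolding vertical_less_pipe_dream_def a using b c by (auto simp del: split_paired_All)
qed

lemma column_to_row_code_eq:
  "column_to_row_code n M = alpha' n w \<longleftrightarrow>
    (\<forall>c\<in>{1..n}. top_pipe n M (1, c) = erase (left_to_right_maxima n (inv w)) (inv w c))"
  by (simp add: column_to_row_code_def alpha'_def erase_def atLeastLessThanSuc_atLeastAtMost
       del: upt_Suc)

text \<open>
  The mark condition is the only part that is not immediate from the description of the words: the
  pipes \<open>q\<close> and \<open>s\<close> that touch in a marked cell form an inversion, which was created at a cross tile
  strictly below, and this tile has lost \<open>s\<close> and become an H-tile with the strand of \<open>q\<close>.
\<close>

lemma Phi_MVPD: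
  assumes w: "w permutes {1..n}" and n: "n \<ge> 1" and P: "P \<in> PD n w"
  shows "Phi n w P \<in> MVPD n w"
proof -
  define S where "S = left_to_right_maxima n (inv w)"
  define M where "M = remove_pipes n S P"
  have pd: "pipe_dream n P" and top: "\<And>c. c \<in> {1..n} \<Longrightarrow> top_pipe n P (1, c) = inv w c"
    using P by (auto simp: PD_def)
  note T = tiles_of_PD(1)[OF pd] and tiles = tiles_of_PD(2)[OF pd]
  have S: "never_overtaken n S P" using wty_Phi(1)[OF w P] by (simp add: S_def)
  have TM: "tiling_of_grid n M" unfolding M_def by (rule tiling_of_grid_remove_pipes[OF T])
  note word = word_remove_pipes[OF T tiles S, folded M_def]
  have labels: "left_pipe n M c = erase S (left_pipe n P c)"
    "bottom_pipe n M c = erase S (bottom_pipe n P c)" if "c \<in> grid n" for c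
  proof -
    obtain i j where ij: "c = (i, j)" by fastforce
    then have pos: "i \<in> {1..n}" "j \<in> {1..n}" using that by (auto simp: grid_def)
    have j: "j \<ge> 1" using pos by simp
    show "left_pipe n M c = erase S (left_pipe n P c)"
      "bottom_pipe n M c = erase S (bottom_pipe n P c)"
      using word[of i j] pos unfolding ij word_here[OF j, symmetric] by simp_all
  qed
  have cross: "M c = (if left_pipe n P c < bottom_pipe n P c
     then if bottom_pipe n P c \<in> S then HTile else Cross
     else if left_pipe n P c \<in> S then MarkedR else Cross)" if "c \<in> grid n" "P c = Cross" for c
    using remove_pipes_cross[OF T S that] by (simp add: M_def)
  have V: "M c \<noteq> VTile" for c
  proof (cases "c \<in> grid n \<and> P c = Cross")
    case True
    then show ?thesis using cross[of c] by simp
  next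
    case False
    then show ?thesis using tiles[of c] remove_pipes_off_grid[OF T, of c S]
      by (auto simp: M_def remove_pipes_def split: if_splits)
  qed
  have mark: "\<exists>(i', j')\<in>grid n. i < i' \<and> M (i', j') = HTile \<and>
      left_pipe n M (i', j') = bottom_pipe n M (i, j)"
    if c: "(i, j) \<in> grid n" and R: "M (i, j) = MarkedR" for i j
  proof -
    have pos: "1 \<le> i" "i \<le> n" "1 \<le> j" "j \<le> n" using c by (auto simp: grid_def)
    define a where "a = i + j - 1"
    have a: "i + j = Suc a" using pos by (auto simp: a_def)
    have here: "left_pipe n P (i, j) = word n P i j a" "bottom_pipe n P (i, j) = word n P i j (Suc a)"
      using word_here[OF pos(3), of n P i] by (simp_all add: a)
    have X: "P (i, j) = Cross" using R tiles[of "(i, j)"]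
      by (auto simp: M_def remove_pipes_def split: if_splits)
    note x = cross_never_overtaken[OF T S c X]
    have pq: "bottom_pipe n P (i, j) < left_pipe n P (i, j)" "left_pipe n P (i, j) \<in> S"
      using cross[OF c X] R x by (auto split: if_splits)
    obtain i' j' where d: "(i', j') \<in> grid n" "i < i'" "P (i', j') = Cross"
      "left_pipe n P (i', j') = bottom_pipe n P (i, j)"
      "bottom_pipe n P (i', j') = left_pipe n P (i, j)"
      using inversion_origin[OF T pos(1,2,3), of a "Suc a"] pq(1) x pos
      unfolding here a by auto
    then have "M (i', j') = HTile" using cross[OF d(1,3)] pq by simp
    moreover have "left_pipe n M (i', j') = bottom_pipe n M (i, j)"
      using labels[OF c] labels[OF d(1)] d by simp
    ultimately show ?thesis using d by blast
  qed
  have "top_pipe n M (1, c) = erase S (inv w c)" if "c \<in> {1..n}" for c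
    using word[of 1 "Suc n"] n that top[OF that] word_end[of c n M] word_end[of c n P] by auto
  then have "column_to_row_code n M = alpha' n w" by (simp add: column_to_row_code_eq S_def)
  then show ?thesis
    using TM V mark
    by (auto simp: MVPD_def Phi_def marked_vertical_less_pipe_dream_def vertical_less_iff
        simp flip: S_def M_def)
qed

section \<open>Restoring the removed pipes\<close>

text \<open>
  The marked tilings that can arise when the pipes in \<open>S\<close> are removed from a pipe dream.
\<close>

locale erased_pipe_dream =
  fixes n :: nat and S :: "nat set" and M :: tiling
  assumes n: "n \<ge> 1"
    and tiling: "tiling_of_grid n M"
    and no_vertical: "M c \<noteq> VTile"
    and marked: "(i, j) \<in> grid n \<Longrightarrow> M (i, j) = MarkedR \<Longrightarrow>
      \<exists>(i', j')\<in>grid n. i < i' \<and> M (i', j') = HTile \<and>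
        left_pipe n M (i', j') = bottom_pipe n M (i, j)"
    and S_subset: "S \<subseteq> {1..n}"
    and entry: "k \<in> {1..n} \<Longrightarrow> meets_left (M (k, 1)) \<longleftrightarrow> k \<notin> S"
begin

definition P :: tiling where
  "P = pipe_dream_of n (wty_MVPD n M)"

lemma pipe_dream: "pipe_dream n P"
  unfolding P_def by (rule pipe_dream_pipe_dream_of)

lemmas tiling_P = tiles_of_PD(1)[OF pipe_dream]

lemma P_tile:
  assumes "(i, j) \<in> grid n"
  shows "P (i, j) = (if Suc n < i + j then Blank else if i + j = Suc n then JTile
    else if M (i, j) \<in> {HTile, Cross, MarkedR} then Cross else Bump)"
  using assms by (simp add: P_def pipe_dream_of_def wty_MVPD_def)

text \<open>
  The three clauses hold when the tracings of \<open>M\<close> and of \<open>P\<close> have reached the cell \<open>(i, j)\<close>.  The second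
  one is needed to see that the pipes cross in \<open>P\<close> where \<open>M\<close> has an H-tile.  The third one remembers,
  for each H-tile of \<open>M\<close> that has been passed, that the pipe in it has been overtaken by a pipe of \<open>S\<close>;
  it is used at the marked R-tiles.
\<close>

definition invariant :: "nat \<Rightarrow> nat \<Rightarrow> bool" where
  "invariant i j \<longleftrightarrow>
     word n M i j = erase S \<circ> word n P i j \<and>
     (\<forall>x y. x < y \<longrightarrow> word n P i j y \<in> S \<longrightarrow> word n P i j x \<noteq> 0 \<longrightarrow>
        word n P i j x < word n P i j y) \<and>
     (\<forall>d\<in>grid n. earlier d (i, j) \<longrightarrow> M d = HTile \<longrightarrow>
        (\<exists>x y. x < y \<and> word n P i j y = left_pipe n M d \<and> word n P i j x \<in> S \<and>
           word n P i j y < word n P i j x))"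

text \<open>
  Outside the staircase nothing moves, and cross tiles of \<open>M\<close> see the same labels in both tracings.
  The second clause of the invariant makes \<open>P\<close> swap at the H-tiles of \<open>M\<close>, and the third one, together
  with the second, keeps it from swapping at the marked R-tiles.
\<close>

lemma invariant_cell:
  assumes c: "(i, j) \<in> grid n" and inv: "invariant i j"
  shows "left_pipe n M (i, j) = erase S (left_pipe n P (i, j))"
    and "bottom_pipe n M (i, j) = erase S (bottom_pipe n P (i, j))"
    and "swaps n M (i, j) \<longleftrightarrow> swaps n P (i, j)"
proof -
  have pos: "1 \<le> i" "i \<le> n" "1 \<le> j" "j \<le> n" using c by (auto simp: grid_def)
  define a where "a = i + j - 1"
  have a: "i + j = Suc a" using pos by (auto simp: a_def)
  define p where "p = word n P i j a"
  define q where "q = word n P i j (Suc a)"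
  have here: "left_pipe n P (i, j) = p" "bottom_pipe n P (i, j) = q"
    using word_here[OF pos(3), of n P i] by (simp_all add: a p_def q_def)
  have word: "word n M i j = erase S \<circ> word n P i j"
    using inv unfolding invariant_def by blast
  have hereM: "left_pipe n M (i, j) = erase S p" "bottom_pipe n M (i, j) = erase S q"
    using word_here[OF pos(3), of n M i] by (simp_all add: a p_def q_def word)
  show "left_pipe n M (i, j) = erase S (left_pipe n P (i, j))"
    "bottom_pipe n M (i, j) = erase S (bottom_pipe n P (i, j))"
    by (simp_all add: here hereM)
  have max: "word n P i j x < word n P i j y"
    if "x < y" "word n P i j y \<in> S" "word n P i j x \<noteq> 0" for x y
    using inv that unfolding invariant_def by blast
  show "swaps n M (i, j) \<longleftrightarrow> swaps n P (i, j)"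
  proof (cases "i + j \<le> n")
    case False
    then have "M (i, j) \<in> {JTile, Blank}"
      using staircase(1)[OF tiling _ c] no_vertical by simp
    then show ?thesis using False P_tile[OF c] by (auto simp: swaps_def)
  next
    case True
    \<comment> \<open>Inside the staircase \<open>P\<close> has cross and bump tiles, so both pipes are present; hence 0 in the
      word of \<open>M\<close> means that the pipe of \<open>P\<close> lies in \<open>S\<close>.\<close>
    have edges: "p \<noteq> 0" "q \<noteq> 0"
      using labels_meet(1,2)[OF tiling_P c] P_tile[OF c] True
      by (auto simp: here meets_left_def meets_bottom_def split: if_splits)
    have edgesM: "p \<notin> S \<longleftrightarrow> meets_left (M (i, j))" "q \<notin> S \<longleftrightarrow> meets_bottom (M (i, j))"
      using labels_meet(1,2)[OF tiling c] edges
      by (auto simp: hereM erase_def split: if_splits)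
    have PX: "P (i, j) = (if M (i, j) \<in> {HTile, Cross, MarkedR} then Cross else Bump)"
      using P_tile[OF c] True by simp
    consider "M (i, j) = HTile" | "M (i, j) = Cross" | "M (i, j) = MarkedR"
      | "M (i, j) \<notin> {HTile, Cross, MarkedR}" by blast
    then show ?thesis
    proof cases
      case 1
      then have "q \<in> S" using edgesM by (simp add: meets_bottom_def)
      then have "p < q" using max[of a "Suc a"] edges by (simp add: p_def q_def)
      then show ?thesis using 1 by (simp add: swaps_def here PX)
    next
      case 2
      then have "p \<notin> S" "q \<notin> S" using edgesM by (simp_all add: meets_bottom_def meets_left_def)
      then show ?thesis using 2 by (simp add: swaps_def here hereM PX erase_def)
    next
      case 3
      then have pq: "p \<in> S" "q \<notin> S" using edgesM by (simp_all add: meets_bottom_def meets_left_def)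
      obtain i' j' where d: "(i', j') \<in> grid n" "i < i'" "M (i', j') = HTile"
          "left_pipe n M (i', j') = q"
        using marked[OF c 3] pq by (auto simp: hereM erase_def)
      then obtain x y where xy: "x < y" "word n P i j y = q" "word n P i j x \<in> S"
          "word n P i j y < word n P i j x"
        using inv unfolding invariant_def by (metis earlier_pair)
      then have "y = Suc a"
        using word_inj[OF tiling_P pos(1,2,3), of y "Suc a"] pos edges by (simp add: q_def)
      \<comment> \<open>The pipe that has overtaken \<open>q\<close> is at or before the position of \<open>p\<close>, and \<open>p\<close> is a left-to-right
        maximum; so \<open>q\<close> is smaller than \<open>p\<close>.\<close>
      then have "x = a \<or> x < a" using xy by auto
      then have "word n P i j x \<le> p"
        using max[of x a] pq xy by (auto simp: p_def)
      then have "q < p" using xy by simp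
      then show ?thesis using 3 by (simp add: swaps_def here PX)
    next
      case 4
      then show ?thesis using no_vertical[of "(i, j)"] by (simp add: swaps_def PX)
    qed
  qed
qed

lemma invariant:
  assumes "1 \<le> i" "i \<le> n" "1 \<le> j" "j \<le> Suc n"
  shows "invariant i j"
  using assms
proof (induction i j rule: reading_order_induct)
  case start
  have P1: "left_pipe n P (k, 1) = (if k \<in> {1..n} then k else 0)" if "k \<le> n" for k
    using pipe_dream that by (auto simp: left_pipe_first pipe_dream_def simp del: One_nat_def)
  have M1: "left_pipe n M (k, 1) = erase S (left_pipe n P (k, 1))" if "k \<le> n" for k
    using entry[of k] P1[OF that] that
    by (auto simp: left_pipe_first erase_def simp del: One_nat_def)
  have "word n M n 1 = erase S \<circ> word n P n 1"
    using M1 by (auto simp: word_start[OF n] simp del: One_nat_def)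
  moreover have "word n P n 1 x < word n P n 1 y"
    if "x < y" "word n P n 1 y \<in> S" "word n P n 1 x \<noteq> 0" for x y
    using that P1[of x] P1[of y] S_subset
    by (auto simp: word_start[OF n] simp del: One_nat_def split: if_splits)
  ultimately show ?case by (auto simp: invariant_def grid_def)
next
  case (cell i j)
  note c = cell(1)
  have pos: "1 \<le> i" "i \<le> n" "1 \<le> j" "j \<le> n" using c by (auto simp: grid_def)
  define a where "a = i + j - 1"
  have a: "i + j = Suc a" using pos by (auto simp: a_def)
  define W where "W = word n P i j"
  have here: "left_pipe n P (i, j) = W a" "bottom_pipe n P (i, j) = W (Suc a)"
    using word_here[OF pos(3), of n P i] by (simp_all add: a W_def)
  note same = invariant_cell[OF c cell(2)]
  have word: "word n M i j = erase S \<circ> W"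
    and max: "\<And>x y. x < y \<Longrightarrow> W y \<in> S \<Longrightarrow> W x \<noteq> 0 \<Longrightarrow> W x < W y"
    and old: "\<And>d. d \<in> grid n \<Longrightarrow> earlier d (i, j) \<Longrightarrow> M d = HTile \<Longrightarrow>
        (\<exists>x y. x < y \<and> W y = left_pipe n M d \<and> W x \<in> S \<and> W y < W x)"
    using cell(2) unfolding invariant_def W_def by blast+
  have step: "word n P i (Suc j) = (if swaps n P (i, j) then swap_next a W else W)"
    using word_step[OF tiling_P c] by (simp add: W_def a_def)
  have Mleft: "left_pipe n M (i, j) \<noteq> 0" if "swaps n M (i, j)"
    using labels_meet(1)[OF tiling c] no_vertical[of "(i, j)"] that
    by (auto simp: swaps_def meets_left_def)
  have 1: "word n M i (Suc j) = erase S \<circ> word n P i (Suc j)"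
    using word_step[OF tiling c] same(3)
    by (auto simp: step word swap_next_def a_def)
  have 2: "word n P i (Suc j) x < word n P i (Suc j) y"
    if xy: "x < y" "word n P i (Suc j) y \<in> S" "word n P i (Suc j) x \<noteq> 0" for x y
  proof (cases "swaps n P (i, j)")
    case False
    then show ?thesis using max xy by (simp add: step)
  next
    case True
    \<comment> \<open>A cell that swaps in \<open>M\<close> has a strand of \<open>M\<close> on the left; so a pipe of \<open>S\<close> never moves to the
      right, and the swapped pair is no exception to the claim.\<close>
    then have "W a \<notin> S" using Mleft same by (auto simp: here erase_def)
    then have "\<not> (x = a \<and> y = Suc a)" using xy True by (auto simp: step)
    then show ?thesis
      using swap_next_pair[OF xy(1), of a W] max xy True by (auto simp: step)
  qed
  have 3: "\<exists>x y. x < y \<and> word n P i (Suc j) y = left_pipe n M d \<and> word n P i (Suc j) x \<in> S \<and>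
      word n P i (Suc j) y < word n P i (Suc j) x"
    if d: "d \<in> grid n" "earlier d (i, Suc j)" "M d = HTile" for d
  proof (cases "d = (i, j)")
    case True
    then have sw: "swaps n M (i, j)" "swaps n P (i, j)" using d same by (auto simp: swaps_def)
    have "left_pipe n M (i, j) = W a" "W a \<noteq> 0"
      using Mleft[OF sw(1)] same(1) by (auto simp: here erase_def split: if_splits)
    moreover have "bottom_pipe n M (i, j) = 0"
      using labels_meet(2)[OF tiling c] d True by (auto simp: meets_bottom_def)
    moreover have "W (Suc a) \<noteq> 0"
    proof -
      have "i + j \<le> n"
        using staircase(1)[OF tiling _ c] no_vertical d True by force
      then show ?thesis using labels_meet(2)[OF tiling_P c] P_tile[OF c]
        by (auto simp: here meets_bottom_def split: if_splits)
    qed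
    ultimately have "W (Suc a) \<in> S" "W a < W (Suc a)"
      using same(2) max[of a "Suc a"] by (auto simp: here erase_def split: if_splits)
    then show ?thesis using sw \<open>left_pipe n M (i, j) = W a\<close> True
      by (intro exI[of _ a] exI[of _ "Suc a"]) (auto simp: step)
  next
    case False
    then have "earlier d (i, j)" using d(2) by (cases d) auto
    then obtain x y where xy: "x < y" "W y = left_pipe n M d" "W x \<in> S" "W y < W x"
      using old d by blast
    have "W y \<noteq> 0" using labels_meet(1)[OF tiling, of "fst d" "snd d"] d xy(2)
      by (simp add: meets_left_def)
    then show ?thesis using inversion_persists[OF tiling_P c xy(1)] xy unfolding W_def by metis
  qed
  show ?case using 1 2 3 unfolding invariant_def by blast
next
  case (row i)
  have "earlier d (Suc i, Suc n)" if "d \<in> grid n" "earlier d (i, 1)" for d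
    using that by (cases d) (auto simp: grid_def)
  then show ?case
    using row(3) unfolding invariant_def word_row[OF tiling row(1,2)] word_row[OF tiling_P row(1,2)]
    by blast
qed

text \<open>
  In the interior of the staircase, a tile of \<open>M\<close> is determined by the edges at which its left and
  bottom strands start and by whether it belongs to the weight.  The labels of \<open>P\<close> tell the former, its
  cross tiles the latter.  Since both tracings swap in the same cells, a cross tile of \<open>P\<close> that keeps
  one strand leaves an H-tile or a marked R-tile, and not a J-tile or a vertical tile.
\<close>

lemma remove_pipes_P: "remove_pipes n S P = M"
proof
  fix c
  show "remove_pipes n S P c = M c"
  proof (cases "c \<in> grid n")
    case False
    then have "M c = Blank" using tiling unfolding tiling_of_grid_def by blast
    then show ?thesis using remove_pipes_off_grid[OF tiling_P False] by simp
  next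
    case True
    obtain i j where ij: "c = (i, j)" by fastforce
    have pos: "1 \<le> i" "i \<le> n" "1 \<le> j" "j \<le> n" using True by (auto simp: grid_def ij)
    have c: "(i, j) \<in> grid n" using True by (simp add: ij)
    have "invariant i j" using invariant pos by simp
    note same = invariant_cell[OF c this]
    note labelsP = labels_meet(1,2)[OF tiling_P c] and labelsM = labels_meet(1,2)[OF tiling c]
    note right = right_pipe_swaps(1)[OF tiling_P c]
    consider "Suc n < i + j" | "i + j = Suc n" | "i + j \<le> n" by linarith
    then show ?thesis
    proof cases
      case 1
      then have "M c = Blank" using staircase(2)[OF tiling _ c] no_vertical by (simp add: ij)
      then show ?thesis using 1 P_tile[OF c] by (simp add: remove_pipes_def ij)
    next
      case 2
      then have "M (i, j) \<in> {JTile, Blank}" using staircase(1)[OF tiling _ c] no_vertical by simp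
      then show ?thesis using 2 P_tile[OF c] labelsP labelsM same
        by (auto simp: remove_pipes_def ij erase_def meets_left_def split: if_splits)
    next
      case 3
      have PX: "P (i, j) = (if M (i, j) \<in> {HTile, Cross, MarkedR} then Cross else Bump)"
        using P_tile[OF c] 3 by simp
      have nz: "left_pipe n P (i, j) \<noteq> 0" "bottom_pipe n P (i, j) \<noteq> 0"
        using labelsP PX by (auto simp: meets_left_def meets_bottom_def split: if_splits)
      have neq: "left_pipe n P (i, j) \<noteq> bottom_pipe n P (i, j)"
        using word_inj[OF tiling_P pos(1,2,3), of "i + j - 1" "i + j"] nz pos
          word_here[OF pos(3), of n P i] by auto
      have keep: "left_pipe n P (i, j) \<notin> S \<longleftrightarrow> meets_left (M (i, j))"
        "bottom_pipe n P (i, j) \<notin> S \<longleftrightarrow> meets_bottom (M (i, j))"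
        using labelsM same nz by (auto simp: erase_def split: if_splits)
      \<comment> \<open>As the two pipes differ, the test on the right label in \<open>remove_pipes\<close> detects the swap.\<close>
      have real: "right_pipe n P (i, j) = left_pipe n P (i, j) \<longleftrightarrow> swaps n M (i, j)"
        using right same neq by auto
      have "rest_of_tile (P (i, j)) (swaps n M (i, j)) (meets_left (M (i, j)))
        (meets_bottom (M (i, j))) = M (i, j)"
        using no_vertical[of "(i, j)"]
        by (cases "M (i, j)"; cases "swaps n M (i, j)")
           (auto simp: PX meets_left_def meets_bottom_def swaps_def)
      then show ?thesis by (simp add: remove_pipes_def ij keep real)
    qed
  qed
qed

text \<open>
  Both \<open>h\<close> and the top row of \<open>P\<close> list the elements of \<open>S\<close> in increasing order on the same positions,
  and a set has only one increasing enumeration.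
\<close>

lemma top_P:
  assumes h: "bij_betw h {1..n} {1..n}"
    and max: "\<And>x y. 1 \<le> x \<Longrightarrow> x < y \<Longrightarrow> y \<le> n \<Longrightarrow> h y \<in> S \<Longrightarrow> h x < h y"
    and code: "\<And>c. c \<in> {1..n} \<Longrightarrow> top_pipe n M (1, c) = erase S (h c)"
    and c: "c \<in> {1..n}"
  shows "top_pipe n P (1, c) = h c"
proof -
  define g where "g c = top_pipe n P (1, c)" for c
  have inv: "invariant 1 (Suc n)" using invariant n by simp
  have word: "word n P 1 (Suc n) c = g c" if "c \<in> {1..n}" for c
    using word_end[of c n P] that by (simp add: g_def)
  have g0: "g c \<noteq> 0" if "c \<in> {1..n}" for c
    using labels_meet(4)[OF tiling_P, of 1 c] pipe_dream that n
    by (auto simp: g_def grid_def pipe_dream_def)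
  have h0: "h c \<noteq> 0" if "c \<in> {1..n}" for c using bij_betwE[OF h] that by fastforce
  have gmax: "g x < g y" if "x \<in> {1..n}" "y \<in> {1..n}" "x < y" "g y \<in> S" for x y
  proof -
    have "word n P 1 (Suc n) x < word n P 1 (Suc n) y"
      if "x < y" "word n P 1 (Suc n) y \<in> S" "word n P 1 (Suc n) x \<noteq> 0" for x y
      using inv that unfolding invariant_def by blast
    from this[OF that(3)] show ?thesis using that word[of x] word[of y] g0[of x] by simp
  qed
  have eq: "erase S (g c) = erase S (h c)" if "c \<in> {1..n}" for c
  proof -
    have "word n M 1 (Suc n) c = erase S (g c)"
      using inv word[OF that] by (simp add: invariant_def)
    then show ?thesis using code[OF that] word_end[of c n M] that by simp
  qed
  have inS: "g c \<in> S \<longleftrightarrow> h c \<in> S" if "c \<in> {1..n}" for c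
    using eq[OF that] g0[OF that] h0[OF that] by (auto simp: erase_def split: if_splits)
  have surj: "\<exists>k\<in>{1..n}. g k = v" if "v \<in> {1..n}" for v
  proof -
    have "v \<in> {k \<in> {1..n}. meets_left (P (k, 1))}"
      using that pipe_dream unfolding pipe_dream_def by blast
    then have "v \<in> {g k |k. k \<in> {1..n}}"
      unfolding pipes_that_exit[OF tiling_P n, symmetric] g_def by blast
    then show ?thesis by blast
  qed
  have "g c = h c" using c
  proof (induction c rule: less_induct)
    case (less c)
    show ?case
    proof (cases "h c \<in> S")
      case False
      then show ?thesis using eq[OF less(2)] inS[OF less(2)] by (simp add: erase_def)
    next
      case True
      have gc: "g c \<in> S" using True inS[OF less(2)] by simp
      obtain d where d: "d \<in> {1..n}" "g d = h c"
        using surj[of "h c"] True S_subset by blast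
      obtain e where e: "e \<in> {1..n}" "h e = g c"
      proof -
        have "g c \<in> h ` {1..n}" using gc S_subset bij_betw_imp_surj_on[OF h] by blast
        then show ?thesis using that by (auto simp del: One_nat_def)
      qed
      \<comment> \<open>Neither \<open>h c\<close> nor \<open>g c\<close> can be taken by the other enumeration at an earlier position, where the two
        agree; by monotonicity each is at most the other.\<close>
      have "\<not> d < c"
      proof
        assume "d < c"
        then have "h d = h c" using less(1)[of d] d by simp
        then have "d = c" using inj_onD[OF bij_betw_imp_inj_on[OF h] _ d(1) less(2)] by simp
        then show False using \<open>d < c\<close> by simp
      qed
      moreover have "\<not> e < c"
      proof
        assume "e < c"
        then have "g e = g c" using less(1)[of e] e by simp
        then show False using gmax[OF e(1) less(2) \<open>e < c\<close> gc] by simp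
      qed
      moreover have "g c \<le> g d" if "c \<le> d"
        using gmax[OF less(2) d(1)] that True d by (cases "c = d") auto
      moreover have "h c \<le> h e" if "c \<le> e"
        using max[of c e] that less(2) e gc by (cases "c = e") auto
      ultimately show ?thesis using d e by simp
    qed
  qed
  then show ?thesis by (simp add: g_def)
qed

end

lemma Phi_surj:
  assumes w: "w permutes {1..n}" and n: "n \<ge> 1" and M: "M \<in> MVPD n w"
  shows "\<exists>P\<in>PD n w. Phi n w P = M"
proof -
  define S where "S = left_to_right_maxima n (inv w)"
  note u = permutes_inv[OF w]
  have bij: "bij_betw (inv w) {1..n} {1..n}" using permutes_imp_bij[OF u] .
  have mv: "marked_vertical_less_pipe_dream n M"
    and code: "\<And>c. c \<in> {1..n} \<Longrightarrow> top_pipe n M (1, c) = erase S (inv w c)"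
    using M column_to_row_code_eq[of n M w] by (auto simp: MVPD_def S_def)
  then have T: "tiling_of_grid n M" and V: "\<And>c. M c \<noteq> VTile"
    by (auto simp: marked_vertical_less_pipe_dream_def vertical_less_iff)
  have sub: "S \<subseteq> {1..n}" using bij_betwE[OF bij] by (auto simp: S_def left_to_right_maxima_def)
  have "{k \<in> {1..n}. meets_left (M (k, 1))} = {erase S (inv w c) |c. c \<in> {1..n}} - {0}"
    unfolding pipes_that_exit[OF T n, symmetric] using code by (metis (no_types, lifting))
  also have "\<dots> = {1..n} - S"
  proof -
    have "inv w c \<in> {1..n}" if "c \<in> {1..n}" for c using bij_betwE[OF bij] that by blast
    moreover have "\<exists>c\<in>{1..n}. inv w c = v" if "v \<in> {1..n}" for v
      using bij that by (metis bij_betw_def imageE)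
    ultimately show ?thesis by (fastforce simp: erase_def split: if_splits)
  qed
  finally have entry: "meets_left (M (k, 1)) \<longleftrightarrow> k \<notin> S" if "k \<in> {1..n}" for k
    using that by blast
  have "\<exists>(i', j')\<in>grid n. i < i' \<and> M (i', j') = HTile \<and>
        left_pipe n M (i', j') = bottom_pipe n M (i, j)"
    if "(i, j) \<in> grid n" "M (i, j) = MarkedR" for i j
    using conjunct2[OF mv[unfolded marked_vertical_less_pipe_dream_def], THEN bspec, OF that(1)] that(2)
    by blast
  then interpret erased_pipe_dream n S M
    using n T V sub entry by unfold_locales
  have "inv w x < inv w y" if "1 \<le> x" "x < y" "y \<le> n" "inv w y \<in> S" for x y
  proof -
    have "inv w x \<noteq> inv w y" using permutes_inj[OF u] that(2) by (metis injD nat_neq_iff)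
    then show ?thesis using permutes_LR_maximum[OF u that(1-3)] that(4) unfolding S_def
      by (meson linorder_neqE_nat)
  qed
  then have "P \<in> PD n w" using pipe_dream top_P[OF bij _ code] by (simp add: PD_def)
  moreover have "Phi n w P = M" using remove_pipes_P by (simp add: Phi_def S_def)
  ultimately show ?thesis by blast
qed

theorem proposition3p6:
  fixes n :: nat and w :: "nat \<Rightarrow> nat"
  assumes "n \<ge> 1" and "w permutes {1..n}"
  shows "bij_betw (Phi n w) (PD n w) (MVPD n w) \<and>
         (\<forall>P\<in>PD n w. wty_MVPD n (Phi n w P) = wty_PD n P)"
proof -
  have "inj_on (Phi n w) (PD n w)"
  proof (rule inj_onI)
    fix P Q assume PQ: "P \<in> PD n w" "Q \<in> PD n w" "Phi n w P = Phi n w Q"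
    then have "wty_PD n P = wty_PD n Q" using wty_Phi(2)[OF assms(2)] by metis
    then show "P = Q" using PQ pipe_dream_eq unfolding PD_def by (metis (no_types, lifting) mem_Collect_eq)
  qed
  moreover have "Phi n w ` PD n w = MVPD n w"
  proof
    show "Phi n w ` PD n w \<subseteq> MVPD n w"
      using Phi_MVPD[OF assms(2,1)] by (rule image_subsetI)
    show "MVPD n w \<subseteq> Phi n w ` PD n w"
      using Phi_surj[OF assms(2,1)] by (metis image_eqI subsetI)
  qed
  ultimately show ?thesis
    using wty_Phi(2)[OF assms(2)] by (simp add: bij_betw_def)
qed

end
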